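(* Let $\mathcal{G}$ be a non-degenerate Hessenberg matrix. Then there exist $d\in\mathbb{Z}_+$ and a vector $\vec{\mu}_d=(\mu_0,\dots,\mu_d)$ of non-negative finite Borel measures on $\mathbb{R}$ with $\mathbb{P}\subset\mathbf{L}_1(\mu_k)$ for $0\le k\le d$, $\mu_0$ positive (nonzero), $\mu_d$ having infinite support and $\mu_0,\dots,\mu_{d-1}$ supported on finite subsets, such that $\langle p,q\rangle_{\vec{\mu}_d}=\langle p,q\rangle_{\mathcal{G}}$ for all $p,q\in\mathbb{P}$, if and only if there exists $d\in\mathbb{Z}_+$ such that 1. $\mathcal{G}$ is a Hessenberg-Sobolev matrix of index $d$; and 2. with the Hankel matrices defined, for $k=0,1,\dots,d$, by $$\mathcal{H}_{d-k}=\frac{(-1)^{d-k}}{(2d-2k)!}\,\Phi(\mathcal{M}_{d-k},2d-2k),$$ where $\mathcal{M}_d=\mathcal{M}_{\mathcal{G}}$ and $\mathcal{M}_{d-k}=\mathcal{M}_{d-k+1}-\mathcal{U}^{-d-1+k}\mathcal{D}_{d+1-k}\mathcal{H}_{d+1-k}\mathcal{D}_{d+1-k}\mathcal{U}^{d+1-k}$ for $k=1,\dots,d$, the matrix $\mathcal{H}_d$ is positive definite of infinite order and, for each $k=1,2,\dots,d$, the matrix $\mathcal{H}_{d-k}$ is positive definite of order $m_k$ for some $m_k\in\mathbb{Z}_+$.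
   Context: $\mathbb{Z}_+=\{0,1,2,\dots\}$; $\mathbb{P}$ is the space of real polynomials. Infinite matrices have real entries indexed by $(i,j)\in\mathbb{Z}_+\times\mathbb{Z}_+$; $\mathcal{O}$ is the infinite null matrix, $\mathcal{I}$ the infinite unit matrix. All products of infinite matrices considered are such that each entry is a sum with finitely many nonzero terms. $\mathcal{U}$ is the infinite matrix with $(i,j)$ entry $\delta_{i+1,j}$; $\mathcal{U}^{-1}:=\mathcal{U}^{\mathsf T}$ and $\mathcal{U}^{-m}:=(\mathcal{U}^{-1})^m$. $[\mathcal{A}]_n$ is the matrix of the first $n$ rows and columns of $\mathcal{A}$; $\mathcal{A}$ is positive definite of infinite order if $\det([\mathcal{A}]_n)>0$ for all $n\ge 1$, and positive definite of order $k$ if $\det([\mathcal{A}]_n)>0$ for $1\le n\le k$ and $\det([\mathcal{A}]_n)=0$ for all $n>k$. A non-degenerate Hessenberg matrix is an infinite real matrix $\mathcal{G}=(g_{i,j})_{i,j\ge0}$ with $g_{i,j}=0$ whenever $j-i>1$ and $g_{i,i+1}\neq 0$ for all $i\ge 0$. The polynomials $\{Q_n\}$ generated by $\mathcal{G}$ are defined by $Q_0=t_{0,0}$ (a fixed constant $t_{0,0}>0$) and $g_{n,n+1}Q_{n+1}(x)=xQ_n(x)-\sum_{k=0}^n g_{n,k}Q_k(x)$, $n\ge 0$. Write $Q_n(x)=\sum_{i=0}^n t_{n,i}x^i$ and let $\mathcal{T}=(t_{n,i})$ be the corresponding lower triangular infinite matrix; it has a unique two-sided lower triangular inverse $\mathcal{T}^{-1}$.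 With $\mathcal{T}^{-\mathsf T}=(\mathcal{T}^{-1})^{\mathsf T}$, the matrix of formal moments of $\mathcal{G}$ is $\mathcal{M}_{\mathcal{G}}=(m_{i,j}):=\mathcal{T}^{-1}\mathcal{T}^{-\mathsf T}$. For $p=\sum_{i=0}^{n_1} a_ix^i$, $q=\sum_{j=0}^{n_2} b_jx^j$, $\langle p,q\rangle_{\mathcal{G}}:=\sum_{i=0}^{n_1}\sum_{j=0}^{n_2}a_i\,m_{i,j}\,b_j$. A matrix $\mathcal{H}=(h_{i,j})$ is Hankel if $h_{i,j+1}=h_{i+1,j}$ for all $i,j\ge 0$. $\mathcal{D}_0=\mathcal{I}$ and, for $k>0$, $\mathcal{D}_k$ is the infinite diagonal matrix with $i$th diagonal entry $\frac{(k+i)!}{i!}$, $i\ge0$. $\mathcal{M}$ is a Hankel-Sobolev matrix if there are Hankel matrices $\{\mathcal{H}_k\}_{k=0}^\infty$ with $\mathcal{M}=\sum_{k=0}^{\infty}\mathcal{U}^{-k}\mathcal{D}_k\mathcal{H}_k\mathcal{D}_k\mathcal{U}^{k}$; it is of index $d\in\mathbb{Z}_+$ if $\mathcal{H}_d\neq\mathcal{O}$ and $\mathcal{H}_k=\mathcal{O}$ for all $k>d$. $\mathcal{G}$ is a Hessenberg-Sobolev matrix of index $d$ if $\mathcal{M}_{\mathcal{G}}$ is a Hankel-Sobolev matrix of index $d$. For $\eta\in\mathbb{Z}_+$, $\Phi(\mathcal{A},\eta):=\sum_{\ell=0}^{\eta}(-1)^\ell\binom{\eta}{\ell}\,\mathcal{U}^{\eta-\ell}\mathcal{A}\,\mathcal{U}^{-\ell}$.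 For such a vector of measures, $\langle f,g\rangle_{\vec{\mu}_d}:=\sum_{k=0}^d\int f^{(k)}(x)g^{(k)}(x)\,d\mu_k(x)$ for $f,g\in\mathbb{P}$, where $f^{(k)}$ is the $k$th derivative. *)

theory Defs
  imports
    "HOL-Analysis.Analysis"
    "HOL-Computational_Algebra.Polynomial"
    "Jordan_Normal_Form.Determinant"
begin

type_synonym inf_mat = "nat \<Rightarrow> nat \<Rightarrow> real"

definition inf_null :: inf_mat where
  "inf_null = (\<lambda>i j. 0)"

definition inf_unit :: inf_mat where
  "inf_unit = (\<lambda>i j. if i = j then 1 else 0)"

text \<open>In every product formed below, each entry is a series with only finitely many
  nonzero terms, so \<^const>\<open>suminf\<close> is a finite sum.\<close>

definition inf_mult :: "inf_mat \<Rightarrow> inf_mat \<Rightarrow> inf_mat" (infixl "\<star>" 70) where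
  "A \<star> B = (\<lambda>i j. \<Sum>k. A i k * B k j)"

definition inf_transpose :: "inf_mat \<Rightarrow> inf_mat" where
  "inf_transpose A = (\<lambda>i j. A j i)"

fun inf_power :: "inf_mat \<Rightarrow> nat \<Rightarrow> inf_mat" where
  "inf_power A 0 = inf_unit"
| "inf_power A (Suc n) = A \<star> inf_power A n"

definition shift_mat :: inf_mat where
  "shift_mat = (\<lambda>i j. if i + 1 = j then 1 else 0)"

text \<open>\<open>U_pow m\<close> and \<open>U_neg_pow m\<close> are the powers of the shift matrix with exponents
  \<open>m\<close> and \<open>-m\<close>; by convention the inverse of the shift matrix is its transpose
  (which is only a right inverse).\<close>

definition U_pow :: "nat \<Rightarrow> inf_mat" where
  "U_pow m = inf_power shift_mat m"

definition U_neg_pow :: "nat \<Rightarrow> inf_mat" where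
  "U_neg_pow m = inf_power (inf_transpose shift_mat) m"

definition leading_minor :: "inf_mat \<Rightarrow> nat \<Rightarrow> real" where
  "leading_minor A n = Determinant.det (Matrix.mat n n (\<lambda>(i, j). A i j))"

definition pos_def_infinite :: "inf_mat \<Rightarrow> bool" where
  "pos_def_infinite A \<longleftrightarrow> (\<forall>n\<ge>1. leading_minor A n > 0)"

definition pos_def_order :: "inf_mat \<Rightarrow> nat \<Rightarrow> bool" where
  "pos_def_order A k \<longleftrightarrow>
     (\<forall>n. 1 \<le> n \<and> n \<le> k \<longrightarrow> leading_minor A n > 0) \<and>
     (\<forall>n>k. leading_minor A n = 0)"

definition lower_triangular :: "inf_mat \<Rightarrow> bool" where
  "lower_triangular A \<longleftrightarrow> (\<forall>i j. i < j \<longrightarrow> A i j = 0)"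

text \<open>The lower triangular two-sided inverse; it exists and is unique when \<open>A\<close> is lower
  triangular with nonzero diagonal entries.\<close>

definition lower_inverse :: "inf_mat \<Rightarrow> inf_mat" where
  "lower_inverse A =
     (THE B. lower_triangular B \<and> A \<star> B = inf_unit \<and> B \<star> A = inf_unit)"

definition nondegenerate_hessenberg :: "inf_mat \<Rightarrow> bool" where
  "nondegenerate_hessenberg G \<longleftrightarrow>
     (\<forall>i j. j > i + 1 \<longrightarrow> G i j = 0) \<and> (\<forall>i. G i (i + 1) \<noteq> 0)"

fun gen_poly :: "inf_mat \<Rightarrow> real \<Rightarrow> nat \<Rightarrow> real poly" where
  "gen_poly G t 0 = [:t:]"
| "gen_poly G t (Suc n) =
     Polynomial.smult (1 / G n (Suc n))
       ([:0, 1:] * gen_poly G t n - (\<Sum>k\<le>n. Polynomial.smult (G n k) (gen_poly G t k)))"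

definition coeff_mat :: "inf_mat \<Rightarrow> real \<Rightarrow> inf_mat" where
  "coeff_mat G t = (\<lambda>n i. coeff (gen_poly G t n) i)"

definition moment_mat :: "inf_mat \<Rightarrow> real \<Rightarrow> inf_mat" where
  "moment_mat G t =
     lower_inverse (coeff_mat G t) \<star> inf_transpose (lower_inverse (coeff_mat G t))"

definition formal_inner :: "inf_mat \<Rightarrow> real \<Rightarrow> real poly \<Rightarrow> real poly \<Rightarrow> real" where
  "formal_inner G t p q =
     (\<Sum>i\<le>degree p. \<Sum>j\<le>degree q. coeff p i * moment_mat G t i j * coeff q j)"

definition hankel :: "inf_mat \<Rightarrow> bool" where
  "hankel H \<longleftrightarrow> (\<forall>i j. H i (j + 1) = H (i + 1) j)"

definition D_mat :: "nat \<Rightarrow> inf_mat" where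
  "D_mat k = (\<lambda>i j. if i = j then fact (k + i) / fact i else 0)"

definition sobolev_term :: "nat \<Rightarrow> inf_mat \<Rightarrow> inf_mat" where
  "sobolev_term k H = U_neg_pow k \<star> D_mat k \<star> H \<star> D_mat k \<star> U_pow k"

text \<open>The series is taken entrywise. The \<open>(i, j)\<close> entry of \<open>sobolev_term k H\<close> vanishes for
  \<open>k > min i j\<close>, so again all sums are finite.\<close>

definition sobolev_decomposition :: "inf_mat \<Rightarrow> (nat \<Rightarrow> inf_mat) \<Rightarrow> bool" where
  "sobolev_decomposition M H \<longleftrightarrow>
     (\<forall>k. hankel (H k)) \<and> M = (\<lambda>i j. \<Sum>k. sobolev_term k (H k) i j)"

definition hankel_sobolev_index :: "inf_mat \<Rightarrow> nat \<Rightarrow> bool" where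
  "hankel_sobolev_index M d \<longleftrightarrow>
     (\<exists>H. sobolev_decomposition M H \<and> H d \<noteq> inf_null \<and> (\<forall>k>d. H k = inf_null))"

definition hessenberg_sobolev_index :: "inf_mat \<Rightarrow> real \<Rightarrow> nat \<Rightarrow> bool" where
  "hessenberg_sobolev_index G t d \<longleftrightarrow> hankel_sobolev_index (moment_mat G t) d"

definition Phi :: "inf_mat \<Rightarrow> nat \<Rightarrow> inf_mat" where
  "Phi A \<eta> =
     (\<lambda>i j. \<Sum>l\<le>\<eta>. (-1) ^ l * real (\<eta> choose l) * (U_pow (\<eta> - l) \<star> A \<star> U_neg_pow l) i j)"

definition hankel_part :: "inf_mat \<Rightarrow> nat \<Rightarrow> inf_mat" where
  "hankel_part M n = (\<lambda>i j. (-1) ^ n / fact (2 * n) * Phi M (2 * n) i j)"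

text \<open>For \<open>k \<le> d\<close>, \<open>residual_mat M d k\<close> and \<open>hankel_comp M d k\<close> are the matrices with
  subscript \<open>d - k\<close> of the descending recursion that starts from the matrix \<open>M\<close> with
  subscript \<open>d\<close>.\<close>

fun residual_mat :: "inf_mat \<Rightarrow> nat \<Rightarrow> nat \<Rightarrow> inf_mat" where
  "residual_mat M d 0 = M"
| "residual_mat M d (Suc k) =
     (\<lambda>i j. residual_mat M d k i j
        - sobolev_term (d - k) (hankel_part (residual_mat M d k) (d - k)) i j)"

definition hankel_comp :: "inf_mat \<Rightarrow> nat \<Rightarrow> nat \<Rightarrow> inf_mat" where
  "hankel_comp M d k = hankel_part (residual_mat M d k) (d - k)"

definition measure_support :: "real measure \<Rightarrow> real set" where
  "measure_support M = {x. \<forall>S. open S \<and> x \<in> S \<longrightarrow> emeasure M S > 0}"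

definition discrete_sobolev_measures :: "nat \<Rightarrow> (nat \<Rightarrow> real measure) \<Rightarrow> bool" where
  "discrete_sobolev_measures d \<mu> \<longleftrightarrow>
     (\<forall>k\<le>d. sets (\<mu> k) = sets borel \<and> finite_measure (\<mu> k) \<and>
        (\<forall>p :: real poly. integrable (\<mu> k) (poly p))) \<and>
     emeasure (\<mu> 0) UNIV > 0 \<and>
     infinite (measure_support (\<mu> d)) \<and>
     (\<forall>k<d. finite (measure_support (\<mu> k)))"

definition sobolev_inner ::
    "nat \<Rightarrow> (nat \<Rightarrow> real measure) \<Rightarrow> real poly \<Rightarrow> real poly \<Rightarrow> real" where
  "sobolev_inner d \<mu> f g =
     (\<Sum>k\<le>d. \<integral>x. poly ((pderiv ^^ k) f) x * poly ((pderiv ^^ k) g) x \<partial>(\<mu> k))"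

end

theory Submission
  imports Defs
    "HOL-Computational_Algebra.Fundamental_Theorem_Algebra"
    "HOL-Probability.Helly_Selection"
begin

text \<open>The \<open>(i, j)\<close> entry of \<open>U\<^sup>-\<^sup>k D\<^sub>k H\<^sub>k D\<^sub>k U\<^sup>k\<close> is a polynomial of degree \<open>2k\<close> in \<open>i\<close> along each
  antidiagonal, times an entry of \<open>H\<^sub>k\<close>. Hence \<open>\<Phi>(\<cdot>, 2d)\<close>, a finite difference of order \<open>2d\<close> along
  antidiagonals, kills the terms with \<open>k < d\<close> and isolates \<open>H\<^sub>d\<close>; by descent the recursion recovers
  every \<open>H\<^sub>k\<close> of a Hankel-Sobolev decomposition, and \<open>H\<^sub>k\<close> is the moment matrix of \<open>\<mu>\<^sub>k\<close>. It remains
  to characterize moment sequences by their Hankel determinants. Let \<open>P\<close> be the monic orthogonal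
  polynomial of degree \<open>n\<close> of a moment functional \<open>L\<close> that is positive definite below degree \<open>n\<close>.
  It has \<open>n\<close> simple real zeros, and interpolation at them represents \<open>L\<close> by \<open>n\<close> point masses on
  all polynomials of degree below \<open>2n\<close>. If all further determinants vanish, then \<open>L\<close> annihilates the
  multiples of \<open>P\<close> and the representation is exact, which gives a finitely supported measure. If
  all determinants are positive, a weak limit of the quadrature measures exists by Helly's theorem
  and solves the moment problem (Hamburger).\<close>

section \<open>Moment functionals and Hankel determinants\<close>

text \<open>This is the linear functional L with L(x^n) = \<open>h n\<close>. Its range of summation
  depends on \<open>p\<close>; \<open>moment_functional_alt\<close> replaces it by a common larger
  range when several polynomials meet.\<close>

definition moment_functional :: "(nat \<Rightarrow> real) \<Rightarrow> real poly \<Rightarrow> real" where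
  "moment_functional h p = (\<Sum>i\<le>degree p. coeff p i * h i)"

lemma moment_functional_alt:
  assumes "degree p \<le> n"
  shows "moment_functional h p = (\<Sum>i\<le>n. coeff p i * h i)"
  unfolding moment_functional_def using assms
  by (intro sum.mono_neutral_left) (auto simp: coeff_eq_0)

lemma moment_functional_add:
  "moment_functional h (p + q) = moment_functional h p + moment_functional h q"
proof -
  let ?n = "max (degree p) (degree q)"
  have "degree (p + q) \<le> ?n" by (rule degree_add_le_max)
  then show ?thesis
    by (simp add: moment_functional_alt[where n = ?n] sum.distrib algebra_simps)
qed

lemma moment_functional_smult:
  "moment_functional h (Polynomial.smult c p) = c * moment_functional h p"
  by (simp add: moment_functional_alt[where n = "degree p"] degree_smult_le sum_distrib_left mult.assoc)

lemma moment_functional_0 [simp]: "moment_functional h 0 = 0"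
  by (simp add: moment_functional_def)

lemma moment_functional_minus: "moment_functional h (- p) = - moment_functional h p"
  using moment_functional_smult[of h "-1" p] by simp

lemma moment_functional_diff:
  "moment_functional h (p - q) = moment_functional h p - moment_functional h q"
  using moment_functional_add[of h p "- q"] by (simp add: moment_functional_minus)

lemma moment_functional_sum:
  "moment_functional h (\<Sum>i\<in>A. f i) = (\<Sum>i\<in>A. moment_functional h (f i))"
  by (induction A rule: infinite_finite_induct) (simp_all add: moment_functional_add)

lemma moment_functional_monom: "moment_functional h (Polynomial.monom c n) = c * h n"
proof -
  have "moment_functional h (Polynomial.monom c n) = (\<Sum>i\<le>n. coeff (Polynomial.monom c n) i * h i)"
    by (rule moment_functional_alt) (rule degree_monom_le)
  also have "\<dots> = (\<Sum>i\<le>n. if i = n then c * h n else 0)"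
    by (intro sum.cong) auto
  finally show ?thesis by simp
qed

lemmas moment_functional_linear =
  moment_functional_add moment_functional_diff moment_functional_smult moment_functional_sum

lemma poly_eq_sum_monom:
  assumes "degree (p :: 'a :: comm_semiring_1 poly) < n"
  shows "p = (\<Sum>i<n. Polynomial.smult (coeff p i) (Polynomial.monom 1 i))"
proof (rule poly_eqI)
  fix k
  have "coeff (\<Sum>i<n. Polynomial.smult (coeff p i) (Polynomial.monom 1 i)) k
      = (\<Sum>i<n. if i = k then coeff p k else 0)"
    unfolding coeff_sum by (intro sum.cong) auto
  also have "\<dots> = coeff p k"
    using assms by (auto simp: coeff_eq_0)
  finally show "coeff p k = coeff (\<Sum>i<n. Polynomial.smult (coeff p i) (Polynomial.monom 1 i)) k" ..
qed

lemma degree_sum_monom_less: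
  assumes "n > 0"
  shows "degree (\<Sum>i<n. Polynomial.smult (c i) (Polynomial.monom (1 :: 'a :: comm_semiring_1) i)) < n"
proof -
  have "degree (\<Sum>i<n. Polynomial.smult (c i) (Polynomial.monom (1::'a) i)) \<le> n - 1"
    using assms by (intro degree_sum_le)
      (auto intro!: order_trans[OF degree_smult_le] order_trans[OF degree_monom_le])
  then show ?thesis using assms by simp
qed

lemma moment_functional_bilinear:
  assumes "degree p < n" and "degree q < m"
  shows "moment_functional h (p * q) = (\<Sum>i<n. \<Sum>j<m. coeff p i * coeff q j * h (i + j))"
proof -
  have "p * q = (\<Sum>i<n. \<Sum>j<m. Polynomial.smult (coeff p i * coeff q j) (Polynomial.monom 1 (i + j)))"
    by (subst (1) poly_eq_sum_monom[OF assms(1)], subst (1) poly_eq_sum_monom[OF assms(2)])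
       (simp add: sum_product mult_monom mult.commute)
  then show ?thesis
    by (simp add: moment_functional_linear moment_functional_monom)
qed

definition hankel_minor :: "(nat \<Rightarrow> real) \<Rightarrow> nat \<Rightarrow> real" where
  "hankel_minor h n = leading_minor (\<lambda>i j. h (i + j)) n"

text \<open>A kernel vector of the Hankel matrix is the coefficient vector of a polynomial
  \<open>q\<close>, and row i of the linear system reads L(x^i q) = 0. So singularity means that the
  form (q, s) -> L(q s) is degenerate on polynomials of degree below \<open>n\<close>.\<close>

lemma hankel_minor_eq_0_iff:
  assumes "n > 0"
  shows "hankel_minor h n = 0 \<longleftrightarrow>
    (\<exists>q. q \<noteq> 0 \<and> degree q < n \<and> (\<forall>s. degree s < n \<longrightarrow> moment_functional h (q * s) = 0))"
proof -
  define A where "A = Matrix.mat n n (\<lambda>(i, j). h (i + j))"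
  have A: "A \<in> carrier_mat n n" by (simp add: A_def)
  have minor: "hankel_minor h n = 0 \<longleftrightarrow>
      (\<exists>v. v \<in> carrier_vec n \<and> v \<noteq> 0\<^sub>v n \<and> A *\<^sub>v v = 0\<^sub>v n)"
    using det_0_iff_vec_prod_zero_field[OF A] by (simp add: hankel_minor_def leading_minor_def A_def)
  have Av: "(A *\<^sub>v v) = Matrix.vec n (\<lambda>i. \<Sum>j<n. h (i + j) * vec_index v j)" if "v \<in> carrier_vec n" for v
    using that by (auto simp: A_def scalar_prod_def atLeast0LessThan intro!: eq_vecI)
  show ?thesis
  proof
    assume "hankel_minor h n = 0"
    then obtain v where v: "v \<in> carrier_vec n" "v \<noteq> 0\<^sub>v n" "A *\<^sub>v v = 0\<^sub>v n"
      using minor by blast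
    define q where "q = (\<Sum>i<n. Polynomial.smult (vec_index v i) (Polynomial.monom 1 i))"
    have cq: "coeff q k = vec_index v k" if "k < n" for k
    proof -
      have "coeff q k = (\<Sum>i<n. if i = k then vec_index v k else 0)"
        unfolding q_def coeff_sum by (intro sum.cong) auto
      then show ?thesis using that by simp
    qed
    have dq: "degree q < n" unfolding q_def by (rule degree_sum_monom_less[OF assms])
    have "q \<noteq> 0"
    proof
      assume "q = 0"
      then have "v = 0\<^sub>v n" using v(1) cq by (intro eq_vecI) auto
      with v(2) show False by simp
    qed
    moreover have "moment_functional h (q * s) = 0" if "degree s < n" for s
    proof -
      have z: "(\<Sum>j<n. h (i + j) * vec_index v j) = 0" if "i < n" for i
        proof -
        have "Matrix.vec n (\<lambda>i. \<Sum>j<n. h (i + j) * vec_index v j) = 0\<^sub>v n"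
          using v(3) Av[OF v(1)] by simp
        from arg_cong[OF this, of "\<lambda>w. vec_index w i"] show ?thesis using that by simp
      qed
      have "moment_functional h (q * s) = (\<Sum>i<n. \<Sum>j<n. coeff s i * coeff q j * h (i + j))"
        using moment_functional_bilinear[OF that dq, of h] by (simp add: mult.commute)
      also have "\<dots> = (\<Sum>i<n. coeff s i * (\<Sum>j<n. h (i + j) * vec_index v j))"
        by (simp add: sum_distrib_left cq mult_ac)
      also have "\<dots> = 0" by (simp add: z)
      finally show ?thesis .
    qed
    ultimately show "\<exists>q. q \<noteq> 0 \<and> degree q < n \<and> (\<forall>s. degree s < n \<longrightarrow> moment_functional h (q * s) = 0)"
      using dq by blast
  next
    assume "\<exists>q. q \<noteq> 0 \<and> degree q < n \<and> (\<forall>s. degree s < n \<longrightarrow> moment_functional h (q * s) = 0)"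
    then obtain q where q: "q \<noteq> 0" "degree q < n"
      "\<And>s. degree s < n \<Longrightarrow> moment_functional h (q * s) = 0" by blast
    define v where "v = Matrix.vec n (coeff q)"
    have v: "v \<in> carrier_vec n" by (simp add: v_def)
    have "v \<noteq> 0\<^sub>v n"
    proof
      assume "v = 0\<^sub>v n"
      then have "coeff q (degree q) = 0"
        using q(2) by (metis index_vec index_zero_vec(1) v_def)
      with q(1) show False by simp
    qed
    moreover have "A *\<^sub>v v = 0\<^sub>v n"
    proof (subst Av[OF v], intro eq_vecI)
      fix i assume "i < dim_vec (0\<^sub>v n)"
      then have i: "i < n" by simp
      have di: "degree (Polynomial.monom (1::real) i) < n" using i by (simp add: degree_monom_eq)
      have "0 = moment_functional h (Polynomial.monom 1 i * q)"
        using q(3)[OF di] by (simp add: mult.commute)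
      also have "\<dots> = (\<Sum>k<n. \<Sum>j<n. coeff (Polynomial.monom 1 i) k * coeff q j * h (k + j))"
        by (rule moment_functional_bilinear[OF di q(2)])
      also have "\<dots> = (\<Sum>k<n. if k = i then \<Sum>j<n. coeff q j * h (i + j) else 0)"
        by (intro sum.cong) auto
      also have "\<dots> = (\<Sum>j<n. h (i + j) * vec_index v j)"
        using i by (simp add: v_def mult.commute)
      finally show "vec_index (Matrix.vec n (\<lambda>i. \<Sum>j<n. h (i + j) * vec_index v j)) i = vec_index (0\<^sub>v n) i"
        using i by simp
    qed simp
    ultimately show "hankel_minor h n = 0" using minor v by blast
  qed
qed

text \<open>If \<open>L(p\<^sub>i\<^sup>2) = 0\<close> for some \<open>i < n\<close>, then division by zero drops the corresponding term.\<close>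

fun orth_poly :: "(nat \<Rightarrow> real) \<Rightarrow> nat \<Rightarrow> real poly" where
  "orth_poly h n = Polynomial.monom 1 n -
     (\<Sum>i<n. Polynomial.smult
       (moment_functional h (Polynomial.monom 1 n * orth_poly h i) /
        moment_functional h (orth_poly h i * orth_poly h i)) (orth_poly h i))"

declare orth_poly.simps [simp del]

lemma degree_orth_poly: "degree (orth_poly h n) = n"
  and coeff_orth_poly: "coeff (orth_poly h n) n = 1"
proof -
  have "degree (orth_poly h n) = n \<and> coeff (orth_poly h n) n = 1"
  proof (induction n rule: less_induct)
    case (less n)
    define S where "S = (\<Sum>i<n. Polynomial.smult
       (moment_functional h (Polynomial.monom 1 n * orth_poly h i) /
        moment_functional h (orth_poly h i * orth_poly h i)) (orth_poly h i))"
    have eq: "orth_poly h n = Polynomial.monom 1 n - S"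
      by (subst orth_poly.simps) (simp add: S_def)
    have c: "coeff S k = 0" if "k \<ge> n" for k
      unfolding S_def coeff_sum using less that by (auto intro!: sum.neutral simp: coeff_eq_0)
    have "coeff (orth_poly h n) n = 1" "\<And>k. k > n \<Longrightarrow> coeff (orth_poly h n) k = 0"
      by (simp_all add: eq c)
    then show ?case
      by (metis degree_le le_antisym le_degree zero_neq_one)
  qed
  then show "degree (orth_poly h n) = n" "coeff (orth_poly h n) n = 1" by auto
qed

lemma orth_poly_nonzero [simp]: "orth_poly h n \<noteq> 0"
  using coeff_orth_poly[of h n] by auto

text \<open>This is Gram-Schmidt. Nonzero norms below \<open>N\<close> suffice up to
  \<open>j = N\<close>, because the construction of \<open>orth_poly h j\<close> divides only by
  norms of index below \<open>j\<close>.\<close>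

lemma orth_poly_orthogonal:
  assumes "\<And>i. i < N \<Longrightarrow> moment_functional h (orth_poly h i * orth_poly h i) \<noteq> 0"
    and "i < j" and "j \<le> N"
  shows "moment_functional h (orth_poly h j * orth_poly h i) = 0"
  using assms(2,3)
proof (induction j arbitrary: i rule: less_induct)
  case (less j)
  let ?L = "moment_functional h" and ?p = "orth_poly h"
  have orth: "?L (?p k * ?p i) = (if k = i then ?L (?p i * ?p i) else 0)" if "k < j" for k
    using less.IH[of k i] less.IH[of i k] less.prems that
    by (cases k i rule: linorder_cases) (auto simp: mult.commute)
  have "?L (?p j * ?p i) = ?L (Polynomial.monom 1 j * ?p i) -
     (\<Sum>k<j. ?L (Polynomial.monom 1 j * ?p k) / ?L (?p k * ?p k) * ?L (?p k * ?p i))"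
    by (subst orth_poly.simps)
       (simp add: left_diff_distrib sum_distrib_right moment_functional_linear)
  also have "(\<Sum>k<j. ?L (Polynomial.monom 1 j * ?p k) / ?L (?p k * ?p k) * ?L (?p k * ?p i)) =
      (\<Sum>k<j. if k = i then ?L (Polynomial.monom 1 j * ?p i) else 0)"
  proof (intro sum.cong refl)
    fix k assume "k \<in> {..<j}"
    then show "?L (Polynomial.monom 1 j * ?p k) / ?L (?p k * ?p k) * ?L (?p k * ?p i) =
        (if k = i then ?L (Polynomial.monom 1 j * ?p i) else 0)"
      using orth[of k] assms(1)[of i] less.prems by (cases "k = i") auto
  qed
  finally show ?case using less.prems by simp
qed

lemma poly_in_span_monic:
  fixes p :: "nat \<Rightarrow> real poly"
  assumes "\<And>i. degree (p i) = i" and "\<And>i. coeff (p i) i = 1" and "degree q < n"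
  shows "\<exists>c. q = (\<Sum>i<n. Polynomial.smult (c i) (p i))"
  using assms(3)
proof (induction n arbitrary: q)
  case (Suc n)
  define r where "r = q - Polynomial.smult (coeff q n) (p n)"
  have r0: "coeff r k = 0" if "k \<ge> n" for k
    using that assms(1,2) Suc.prems by (cases "k = n") (auto simp: r_def coeff_eq_0)
  show ?case
  \<comment> \<open>For \<open>n = 0\<close> the remainder is 0, but its degree is not below
    \<open>n\<close>, so the induction hypothesis does not apply to it.\<close>
  proof (cases "n = 0")
    case True
    have "r = 0" using r0 True by (intro poly_eqI) auto
    then have "q = Polynomial.smult (coeff q n) (p n)" by (simp add: r_def)
    then show ?thesis using True by (intro exI[of _ "\<lambda>_. coeff q n"]) simp
  next
    case False
    have "degree r \<le> n - 1" using r0 by (intro degree_le) auto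
    with False have "degree r < n" by simp
    from Suc.IH[OF this] obtain c where c: "r = (\<Sum>i<n. Polynomial.smult (c i) (p i))" by blast
    have "q = (\<Sum>i<Suc n. Polynomial.smult ((c(n := coeff q n)) i) (p i))"
      using c by (simp add: r_def algebra_simps)
    then show ?thesis by blast
  qed
qed simp

lemma orth_poly_orthogonal_lower:
  assumes "\<And>i. i < n \<Longrightarrow> moment_functional h (orth_poly h i * orth_poly h i) \<noteq> 0"
    and "degree q < n"
  shows "moment_functional h (orth_poly h n * q) = 0"
proof -
  obtain c where c: "q = (\<Sum>i<n. Polynomial.smult (c i) (orth_poly h i))"
    using poly_in_span_monic[of "orth_poly h", OF degree_orth_poly coeff_orth_poly assms(2)] by blast
  show ?thesis
    unfolding c sum_distrib_left
    using orth_poly_orthogonal[where N=n, OF assms(1)]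
    by (simp add: moment_functional_linear)
qed

text \<open>The coefficients of the orthogonal polynomials form a unit lower triangular matrix T,
  and T A T^T is their Gram matrix, which is diagonal. The last norm may vanish, which lets the
  formula determine its sign from the minor.\<close>

lemma hankel_minor_eq_prod:
  assumes "\<And>i. Suc i < n \<Longrightarrow> moment_functional h (orth_poly h i * orth_poly h i) \<noteq> 0"
  shows "hankel_minor h n = (\<Prod>i<n. moment_functional h (orth_poly h i * orth_poly h i))"
proof -
  let ?L = "moment_functional h" and ?p = "orth_poly h"
  define A where "A = Matrix.mat n n (\<lambda>(i, j). h (i + j))"
  define T where "T = Matrix.mat n n (\<lambda>(i, j). coeff (?p i) j)"
  have carr: "A \<in> carrier_mat n n" "T \<in> carrier_mat n n" "T\<^sup>T \<in> carrier_mat n n"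
    by (simp_all add: A_def T_def)
  have orth: "?L (?p i * ?p j) = 0" if "i < n" "j < n" "i \<noteq> j" for i j
    using orth_poly_orthogonal[of "n - 1" h j i] orth_poly_orthogonal[of "n - 1" h i j] that assms
    by (cases i j rule: linorder_cases) (auto simp: mult.commute)
  have "Determinant.det T = prod_list (diag_mat T)"
    by (rule det_lower_triangular[of n]) (auto simp: T_def coeff_eq_0 degree_orth_poly)
  also have "diag_mat T = map (\<lambda>i. 1) [0..<n]"
    by (auto simp: diag_mat_def T_def coeff_orth_poly)
  finally have detT: "Determinant.det T = 1" by (simp add: map_replicate_const prod_list_replicate)
  have prod_upt: "prod_list (map f [0..<n]) = (\<Prod>i<n. f i)" for f :: "nat \<Rightarrow> real"
    by (simp add: prod.distinct_set_conv_list[symmetric] atLeast0LessThan)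
  have TAT: "T * A * T\<^sup>T = Matrix.mat n n (\<lambda>(i, j). ?L (?p i * ?p j))"
  proof (rule eq_matI)
    fix i j assume "i < dim_row (Matrix.mat n n (\<lambda>(i, j). ?L (?p i * ?p j)))"
      and "j < dim_col (Matrix.mat n n (\<lambda>(i, j). ?L (?p i * ?p j)))"
    then have ij: "i < n" "j < n" by auto
    have "(T * A * T\<^sup>T) $$ (i, j) = (\<Sum>l<n. (\<Sum>k<n. coeff (?p i) k * h (k + l)) * coeff (?p j) l)"
      using ij by (simp add: T_def A_def scalar_prod_def atLeast0LessThan)
    also have "\<dots> = (\<Sum>k<n. \<Sum>l<n. coeff (?p i) k * coeff (?p j) l * h (k + l))"
      by (subst sum.swap) (simp add: sum_distrib_right sum_distrib_left mult_ac)
    also have "\<dots> = ?L (?p i * ?p j)"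
      using ij by (intro moment_functional_bilinear[symmetric]) (auto simp: degree_orth_poly)
    finally show "(T * A * T\<^sup>T) $$ (i, j) = Matrix.mat n n (\<lambda>(i, j). ?L (?p i * ?p j)) $$ (i, j)"
      using ij by simp
  qed (auto simp: T_def)
  have "Determinant.det (T * A * T\<^sup>T) = Determinant.det A"
    using carr detT by (simp add: det_mult[of _ n] det_transpose[OF carr(2)])
  moreover have "Determinant.det (Matrix.mat n n (\<lambda>(i, j). ?L (?p i * ?p j))) =
      prod_list (diag_mat (Matrix.mat n n (\<lambda>(i, j). ?L (?p i * ?p j))))"
    by (rule det_lower_triangular[of n]) (auto simp: orth)
  moreover have "diag_mat (Matrix.mat n n (\<lambda>(i, j). ?L (?p i * ?p j))) = map (\<lambda>i. ?L (?p i * ?p i)) [0..<n]"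
    by (auto simp: diag_mat_def)
  ultimately show ?thesis
    unfolding TAT by (simp add: hankel_minor_def leading_minor_def A_def prod_upt)
qed

section \<open>Positive definiteness of the Hankel form and the signs of its minors\<close>

definition pos_def_below :: "(nat \<Rightarrow> real) \<Rightarrow> nat \<Rightarrow> bool" where
  "pos_def_below h N \<longleftrightarrow> (\<forall>q. q \<noteq> 0 \<and> degree q < N \<longrightarrow> moment_functional h (q * q) > 0)"

lemma pos_def_belowD:
  "pos_def_below h N \<Longrightarrow> q \<noteq> 0 \<Longrightarrow> degree q < N \<Longrightarrow> moment_functional h (q * q) > 0"
  by (auto simp: pos_def_below_def)

text \<open>In the orthogonal basis L(q^2) becomes a sum of squares of coordinates weighted by the
  positive norms.\<close>

lemma pos_def_below_orth_poly:
  assumes "\<And>i. i < N \<Longrightarrow> moment_functional h (orth_poly h i * orth_poly h i) > 0"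
  shows "pos_def_below h N"
  unfolding pos_def_below_def
proof (intro allI impI, elim conjE)
  fix q :: "real poly" assume q: "q \<noteq> 0" "degree q < N"
  let ?L = "moment_functional h" and ?p = "orth_poly h"
  obtain c where c: "q = (\<Sum>i<N. Polynomial.smult (c i) (?p i))"
    using poly_in_span_monic[of "orth_poly h", OF degree_orth_poly coeff_orth_poly q(2)] by blast
  have orth: "?L (?p i * ?p j) = 0" if "i < N" "j < N" "i \<noteq> j" for i j
    using orth_poly_orthogonal[of N h j i] orth_poly_orthogonal[of N h i j] that assms
    by (cases i j rule: linorder_cases) (force simp: mult.commute)+
  have "?L (q * q) = (\<Sum>i<N. \<Sum>j<N. c i * (c j * ?L (?p i * ?p j)))"
    unfolding c by (simp add: sum_product moment_functional_linear mult_ac)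
  also have "\<dots> = (\<Sum>i<N. \<Sum>j<N. if j = i then c i * (c i * ?L (?p i * ?p i)) else 0)"
    using orth by (intro sum.cong) auto
  also have "\<dots> = (\<Sum>i<N. (c i)\<^sup>2 * ?L (?p i * ?p i))"
    by (simp add: power2_eq_square mult.assoc)
  finally have eq: "?L (q * q) = (\<Sum>i<N. (c i)\<^sup>2 * ?L (?p i * ?p i))" .
  have "\<exists>i<N. c i \<noteq> 0"
    using q(1) c by (metis (no_types, lifting) lessThan_iff smult_0_left sum.neutral)
  then obtain i where i: "i < N" "c i \<noteq> 0" by blast
  show "?L (q * q) > 0"
    unfolding eq using i assms by (intro sum_pos2[of _ i]) (auto intro!: mult_nonneg_nonneg mult_pos_pos simp: less_imp_le)
qed

text \<open>This is Sylvester's criterion for Hankel forms. The minor of order \<open>Suc i\<close>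
  is a product of norms; once the earlier norms are positive, the last one inherits the sign of the
  minor.\<close>

lemma pos_def_below_iff_minors:
  "pos_def_below h N \<longleftrightarrow> (\<forall>n\<le>N. hankel_minor h n > 0)"
proof
  assume pd: "pos_def_below h N"
  have "moment_functional h (orth_poly h i * orth_poly h i) > 0" if "i < N" for i
    using pos_def_belowD[OF pd] that by (simp add: degree_orth_poly)
  then show "\<forall>n\<le>N. hankel_minor h n > 0"
    by (auto intro!: prod_pos simp: hankel_minor_eq_prod[OF less_imp_neq[symmetric]] hankel_minor_eq_prod)
next
  assume D: "\<forall>n\<le>N. hankel_minor h n > 0"
  have "moment_functional h (orth_poly h i * orth_poly h i) > 0" if "i < N" for i
    using that
  proof (induction i rule: less_induct)
    case (less i)
    have IH: "moment_functional h (orth_poly h k * orth_poly h k) > 0" if "k < i" for k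
      using less that by simp
    have "0 < hankel_minor h (Suc i)" using D less.prems by simp
    also have "hankel_minor h (Suc i) = (\<Prod>k<Suc i. moment_functional h (orth_poly h k * orth_poly h k))"
      by (rule hankel_minor_eq_prod) (use IH in fastforce)
    finally show ?case
      using IH prod_pos[of "{..<i}" "\<lambda>k. moment_functional h (orth_poly h k * orth_poly h k)"]
      by (auto simp: zero_less_mult_iff)
  qed
  then show "pos_def_below h N" by (rule pos_def_below_orth_poly)
qed

section \<open>Gaussian quadrature\<close>

lemma root_product_dvd:
  fixes p :: "'a :: field poly"
  assumes "finite X" and "\<And>x. x \<in> X \<Longrightarrow> poly p x = 0"
  shows "(\<Prod>x\<in>X. [:- x, 1:]) dvd p"
  using assms
proof (induction X rule: finite_induct)
  case (insert x X)
  then obtain g where g: "p = (\<Prod>x\<in>X. [:- x, 1:]) * g" by (auto elim: dvdE)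
  have "poly p x = 0" using insert.prems by simp
  moreover have "poly (\<Prod>x\<in>X. [:- x, 1:]) x \<noteq> 0"
    using insert.hyps by (auto simp: poly_prod)
  ultimately have "poly g x = 0" by (simp add: g)
  then have "[:- x, 1:] dvd g" by (simp add: poly_eq_0_iff_dvd)
  then show ?case
    unfolding g prod.insert[OF insert.hyps] mult.commute[of _ g] by (rule mult_dvd_mono) simp
qed simp

lemma degree_root_product:
  "degree (\<Prod>x\<in>X. [:- x, 1:] :: 'a :: field poly) = card X"
  by (subst degree_prod_sum_eq) auto

lemma poly_map_poly_of_real:
  fixes p q :: "real poly" and z :: "'a :: {comm_ring_1, real_algebra_1}"
  shows "poly (map_poly of_real (p + q)) z = poly (map_poly of_real p) z + poly (map_poly of_real q) z"
    and "poly (map_poly of_real (p * q)) z = poly (map_poly of_real p) z * poly (map_poly of_real q) z"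
    and "poly (map_poly of_real p) (of_real x) = of_real (poly p x)"
proof -
  have add: "poly (map_poly of_real (p + q)) z = poly (map_poly of_real p) z + poly (map_poly of_real q) z"
    for p q :: "real poly"
    by (induction p q rule: poly_induct2) (simp_all add: map_poly_pCons algebra_simps)
  then show "poly (map_poly of_real (p + q)) z = poly (map_poly of_real p) z + poly (map_poly of_real q) z" .
  have smult: "poly (map_poly of_real (Polynomial.smult c q)) z = of_real c * poly (map_poly of_real q) z" for c
    by (induction q) (simp_all add: map_poly_pCons algebra_simps)
  show "poly (map_poly of_real (p * q)) z = poly (map_poly of_real p) z * poly (map_poly of_real q) z"
    by (induction p) (simp_all add: map_poly_pCons add smult algebra_simps)
  show "poly (map_poly of_real p) (of_real x) = of_real (poly p x)"
    by (induction p) (simp_all add: map_poly_pCons)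
qed

text \<open>Take a complex root z = a + ib. If b is nonzero, the remainder of \<open>g\<close>
  modulo the real quadratic with roots z and its conjugate is c + d x and vanishes at z; the
  imaginary part gives d = 0, then the real part c = 0.\<close>

lemma real_poly_linear_or_quadratic_factor:
  fixes g :: "real poly"
  assumes "degree g > 0"
  obtains a where "[:- a, 1:] dvd g"
    | a b where "b \<noteq> 0" and "[:a\<^sup>2 + b\<^sup>2, - 2 * a, 1:] dvd g"
proof -
  have "\<not> constant (poly (map_poly complex_of_real g))"
    using assms by (simp add: constant_degree degree_map_poly)
  then obtain z where z: "poly (map_poly complex_of_real g) z = 0"
    using fundamental_theorem_of_algebra by blast
  show thesis
  proof (cases "Im z = 0")
    case True
    then have "z = complex_of_real (Re z)" by (simp add: complex_eq_iff)
    then have "poly g (Re z) = 0"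
      using z by (metis of_real_eq_0_iff poly_map_poly_of_real(3))
    then show thesis using that(1) by (simp add: poly_eq_0_iff_dvd)
  next
    case False
    define a b where "a = Re z" and "b = Im z"
    define Q where "Q = [:a\<^sup>2 + b\<^sup>2, - 2 * a, 1:]"
    have zab: "z = Complex a b" by (simp add: a_def b_def)
    have b: "b \<noteq> 0" using False by (simp add: b_def)
    have dQ: "degree Q = 2" and Q0: "Q \<noteq> 0" by (simp_all add: Q_def)
    define r where "r = g mod Q"
    have "degree r \<le> 1"
      using degree_mod_less[OF Q0, of g] dQ by (auto simp: r_def)
    then obtain c d where r: "r = [:c, d:]"
      by (metis One_nat_def degree_0 degree_eq_zeroE degree_pCons_eq_if le_Suc_eq le_zero_eq nat.inject pCons_0_0 pCons_cases)
    have Qz: "poly (map_poly complex_of_real Q) z = 0"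
      by (simp add: Q_def zab complex_eq_iff power2_eq_square map_poly_pCons algebra_simps)
    have "g = g div Q * Q + r" by (simp add: r_def)
    then have "poly (map_poly complex_of_real r) z = 0"
      using z Qz by (metis add_0 mult_zero_right poly_map_poly_of_real(1,2))
    then have "complex_of_real c + z * complex_of_real d = 0" by (simp add: r map_poly_pCons)
    then have "d * b = 0" "c + a * d = 0" by (auto simp: zab complex_eq_iff)
    with b have "r = 0" by (simp add: r)
    then have "Q dvd g" by (simp add: r_def dvd_eq_mod_eq_0)
    then show thesis using that(2) b by (simp add: Q_def)
  qed
qed

text \<open>The setting of Gaussian quadrature. The sign of L(P^2) is left open, so the locale
  covers both a positive definite L, where L(P^2) > 0, and one of finite order, where it
  vanishes.\<close>

locale quasi_orthogonal =
  fixes h :: "nat \<Rightarrow> real" and P :: "real poly"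
  assumes pos_def: "pos_def_below h (degree P)"
    and nonzero: "P \<noteq> 0"
    and orthogonal: "\<And>q. degree q < degree P \<Longrightarrow> moment_functional h (P * q) = 0"
begin

definition nodes :: "real set" where "nodes = {x. poly P x = 0}"

lemma finite_nodes: "finite nodes"
  using poly_roots_finite[OF nonzero] by (simp add: nodes_def)

text \<open>A factor \<open>u\<^sup>2 + b\<^sup>2\<close> of \<open>P\<close> with \<open>u\<close> linear, and \<open>P = (u\<^sup>2 + b\<^sup>2) g\<close>, would give
  \<open>0 = L (P g) = L ((u g)\<^sup>2) + b\<^sup>2 L (g\<^sup>2) > 0\<close>.\<close>

lemma no_sum_of_squares_factor: "\<not> [:a\<^sup>2 + b\<^sup>2, - 2 * a, 1:] dvd P"
proof
  let ?L = "moment_functional h"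
  assume "[:a\<^sup>2 + b\<^sup>2, - 2 * a, 1:] dvd P"
  then obtain g where g: "P = [:a\<^sup>2 + b\<^sup>2, - 2 * a, 1:] * g" by (elim dvdE)
  have g0: "g \<noteq> 0" using nonzero g by auto
  have "degree P = degree [:a\<^sup>2 + b\<^sup>2, - 2 * a, 1:] + degree g"
    unfolding g by (rule degree_mult_eq) (use g0 in auto)
  then have dP: "degree P = 2 + degree g" by simp
  define u where "u = [:- a, 1:]"
  have "[:a\<^sup>2 + b\<^sup>2, - 2 * a, 1:] = u * u + [:b\<^sup>2:]"
    by (simp add: u_def power2_eq_square)
  then have "P * g = (u * g) * (u * g) + [:b\<^sup>2:] * (g * g)"
    unfolding g by (simp only: distrib_left distrib_right mult_ac)
  then have "P * g = (u * g) * (u * g) + Polynomial.smult (b\<^sup>2) (g * g)" by simp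
  then have "?L (P * g) = ?L ((u * g) * (u * g)) + b\<^sup>2 * ?L (g * g)"
    by (simp only: moment_functional_linear)
  moreover have "?L (P * g) = 0" using orthogonal dP by simp
  moreover have "degree (u * g) = 1 + degree g"
    by (subst degree_mult_eq) (use g0 in \<open>auto simp: u_def\<close>)
  then have "?L ((u * g) * (u * g)) > 0"
    using g0 dP by (intro pos_def_belowD[OF pos_def]) (auto simp: u_def)
  moreover have "?L (g * g) > 0"
    using g0 dP by (intro pos_def_belowD[OF pos_def]) auto
  ultimately show False
    by (smt (verit) mult_nonneg_nonneg zero_le_power2)
qed

text \<open>If splitting off the distinct real roots left a nonconstant cofactor, it would
  contribute a repeated real root or a quadratic with nonreal roots. Both have the form (x - a)^2 +
  b^2, with b = 0 for the repeated root, and are excluded as factors of \<open>P\<close>.\<close>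

lemma card_nodes: "card nodes = degree P"
proof -
  define Z where "Z = (\<Prod>x\<in>nodes. [:- x, 1:])"
  have "Z dvd P" unfolding Z_def by (rule root_product_dvd[OF finite_nodes]) (simp add: nodes_def)
  then obtain g where g: "P = Z * g" by (elim dvdE)
  have g0: "g \<noteq> 0" using nonzero g by auto
  have "\<not> degree g > 0"
  proof
    assume "degree g > 0"
    then show False
    proof (cases rule: real_poly_linear_or_quadratic_factor)
      case (1 a)
      then have "poly P a = 0" by (metis g dvd_mult poly_eq_0_iff_dvd)
      then have "a \<in> nodes" by (simp add: nodes_def)
      then have "[:- a, 1:] dvd Z" unfolding Z_def using finite_nodes by (intro dvd_prodI)
      with 1 have "[:- a, 1:] * [:- a, 1:] dvd P" unfolding g by (intro mult_dvd_mono)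
      then have "[:a\<^sup>2 + 0\<^sup>2, - 2 * a, 1:] dvd P" by (simp add: power2_eq_square)
      then show False using no_sum_of_squares_factor by blast
    next
      case (2 a b)
      then show False using no_sum_of_squares_factor g dvd_mult by metis
    qed
  qed
  then have "degree g = 0" by simp
  moreover have "degree P = degree Z + degree g"
    by (subst g, rule degree_mult_eq) (use g0 g nonzero in auto)
  ultimately show ?thesis by (simp add: Z_def degree_root_product)
qed

definition lagrange :: "real \<Rightarrow> real poly" where
  "lagrange x = Polynomial.smult (1 / (\<Prod>y\<in>nodes - {x}. x - y)) (\<Prod>y\<in>nodes - {x}. [:- y, 1:])"

text \<open>These are the Christoffel numbers: L applied to the interpolation formula weights the
  value at the node \<open>x\<close> by L of its Lagrange polynomial.\<close>

definition weight :: "real \<Rightarrow> real" where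
  "weight x = moment_functional h (lagrange x)"

lemma poly_lagrange:
  assumes "x \<in> nodes" and "y \<in> nodes"
  shows "poly (lagrange x) y = (if y = x then 1 else 0)"
proof -
  have "(\<Prod>y\<in>nodes - {x}. x - y) \<noteq> 0" using finite_nodes by auto
  then show ?thesis
    using assms finite_nodes by (auto simp: lagrange_def poly_prod)
qed

lemma degree_lagrange: "x \<in> nodes \<Longrightarrow> degree (lagrange x) < degree P"
proof -
  assume x: "x \<in> nodes"
  have "degree (lagrange x) \<le> card (nodes - {x})"
    unfolding lagrange_def using degree_smult_le degree_root_product by metis
  moreover have "card (nodes - {x}) < card nodes"
    using x finite_nodes by (intro psubset_card_mono) auto
  ultimately show ?thesis by (simp add: card_nodes)
qed

lemma lagrange_interpolation:
  assumes "degree r < degree P"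
  shows "r = (\<Sum>x\<in>nodes. Polynomial.smult (poly r x) (lagrange x))"
proof (rule poly_eqI_degree)
  fix y assume y: "y \<in> nodes"
  have "poly (\<Sum>x\<in>nodes. Polynomial.smult (poly r x) (lagrange x)) y
      = (\<Sum>x\<in>nodes. if x = y then poly r y else 0)"
    unfolding poly_sum using y by (intro sum.cong) (auto simp: poly_lagrange)
  then show "poly r y = poly (\<Sum>x\<in>nodes. Polynomial.smult (poly r x) (lagrange x)) y"
    using y finite_nodes by simp
next
  show "degree r < card nodes" using assms by (simp add: card_nodes)
  have "degree (\<Sum>x\<in>nodes. Polynomial.smult (poly r x) (lagrange x)) \<le> degree P - 1"
    using degree_lagrange finite_nodes
    by (intro degree_sum_le) (fastforce intro: order_trans[OF degree_smult_le])+
  then show "degree (\<Sum>x\<in>nodes. Polynomial.smult (poly r x) (lagrange x)) < card nodes"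
    using assms by (simp add: card_nodes)
qed

text \<open>In p = P u + r the product vanishes at the nodes and, by assumption, under L, while
  interpolation is exact on r. Assuming this for the one quotient u serves both the range of degrees
  below \<open>2 * degree P\<close> and functionals that annihilate every multiple of
  \<open>P\<close>.\<close>

lemma quadrature:
  assumes "moment_functional h (P * (p div P)) = 0"
  shows "moment_functional h p = (\<Sum>x\<in>nodes. weight x * poly p x)"
\<comment> \<open>For constant \<open>P\<close> there are no nodes, and the zero remainder does not
  have degree below \<open>degree P\<close>; here the assumption itself says L(p) = 0.\<close>
proof (cases "degree P = 0")
  case True
  then obtain c where c: "P = [:c:]" by (rule degree_eq_zeroE)
  then have "P * (p div P) = p" using nonzero by (metis dvd_mult_div_cancel is_unit_const_poly_iff dvd_field_iff unit_imp_dvd pCons_eq_0_iff)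
  moreover have "nodes = {}" unfolding nodes_def using c nonzero by auto
  ultimately show ?thesis using assms by simp
next
  case False
  define r where "r = p mod P"
  have p: "p = P * (p div P) + r" by (simp add: r_def)
  have dr: "degree r < degree P"
    unfolding r_def using degree_mod_less[OF nonzero, of p] False by auto
  have pr: "poly p x = poly r x" if "x \<in> nodes" for x
    using arg_cong[OF p, of "\<lambda>q. poly q x"] that by (simp add: nodes_def)
  have "moment_functional h p = moment_functional h r"
    by (subst p) (simp add: moment_functional_add assms)
  also have "\<dots> = (\<Sum>x\<in>nodes. poly r x * weight x)"
    by (subst lagrange_interpolation[OF dr]) (simp add: moment_functional_linear weight_def)
  finally show ?thesis using pr by (simp add: mult.commute)
qed

lemma quadrature_degree:
  assumes "degree p < 2 * degree P"
  shows "moment_functional h p = (\<Sum>x\<in>nodes. weight x * poly p x)"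
proof (rule quadrature, rule orthogonal)
  show "degree (p div P) < degree P"
  proof (cases "p div P = 0")
    case False
    have "degree (P * (p div P)) = degree P + degree (p div P)"
      using nonzero False by (rule degree_mult_eq)
    moreover have "P * (p div P) = p - p mod P" by (simp add: minus_mod_eq_mult_div)
    ultimately have "degree P + degree (p div P) \<le> max (degree p) (degree (p mod P))"
      by (metis degree_diff_le_max)
    then show ?thesis
      using assms degree_mod_less[OF nonzero, of p] by (auto simp: max_def split: if_splits)
  qed (use assms in simp)
qed

text \<open>The square of a Lagrange polynomial is within the range of exactness, and quadrature
  evaluates it to the weight of its node.\<close>

lemma weight_pos: "x \<in> nodes \<Longrightarrow> weight x > 0"
proof -
  assume x: "x \<in> nodes"
  let ?q = "lagrange x * lagrange x"
  have l0: "lagrange x \<noteq> 0" using poly_lagrange[OF x x] by auto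
  have "degree ?q < 2 * degree P"
    using degree_lagrange[OF x] l0 by (simp add: degree_mult_eq)
  then have "moment_functional h ?q = (\<Sum>y\<in>nodes. weight y * poly ?q y)"
    by (rule quadrature_degree)
  also have "\<dots> = (\<Sum>y\<in>nodes. if y = x then weight x else 0)"
    using x by (intro sum.cong) (auto simp: poly_lagrange)
  also have "\<dots> = weight x" using x finite_nodes by simp
  finally show ?thesis
    using pos_def_belowD[OF pos_def l0 degree_lagrange[OF x]] by simp
qed

end

lemma quasi_orthogonal_orth_poly:
  assumes "pos_def_below h n"
  shows "quasi_orthogonal h (orth_poly h n)"
proof
  show "moment_functional h (orth_poly h n * q) = 0" if "degree q < degree (orth_poly h n)" for q
  proof (rule orth_poly_orthogonal_lower)
    show "moment_functional h (orth_poly h i * orth_poly h i) \<noteq> 0" if "i < n" for i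
      using pos_def_belowD[OF assms, of "orth_poly h i"] that by (simp add: degree_orth_poly)
  qed (use that in \<open>simp add: degree_orth_poly\<close>)
qed (use assms in \<open>simp_all add: degree_orth_poly\<close>)

text \<open>If \<open>L(P x\<^sup>j) \<noteq> 0\<close> for a least \<open>j\<close>, where \<open>P\<close> is the orthogonal polynomial of degree \<open>m\<close>,
  then no nonzero polynomial of degree at most \<open>j\<close> is in the kernel of the Hankel form of order
  \<open>j + 1\<close>, so that \<open>D\<^bsub>j+1\<^esub> \<noteq> 0\<close>.\<close>

lemma orth_poly_annihilates:
  assumes pos: "pos_def_below h m" and zero: "\<And>n. n > m \<Longrightarrow> hankel_minor h n = 0"
  shows "moment_functional h (orth_poly h m * q) = 0"
proof -
  interpret quasi_orthogonal h "orth_poly h m" by (rule quasi_orthogonal_orth_poly[OF pos])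
  let ?L = "moment_functional h" and ?P = "orth_poly h m"
  have mon: "?L (?P * Polynomial.monom 1 j) = 0" for j
  proof (induction j rule: less_induct)
    case (less j)
    have low: "?L (?P * s) = 0" if "degree s < j" for s
    proof -
      have "?L (?P * s) = ?L (?P * (\<Sum>i<j. Polynomial.smult (coeff s i) (Polynomial.monom 1 i)))"
        using poly_eq_sum_monom[OF that] by simp
      then show ?thesis
        using less.IH by (simp add: sum_distrib_left moment_functional_linear)
    qed
    show ?case
    proof (cases "j < m")
      case True
      then show ?thesis by (intro orthogonal) (simp add: degree_monom_eq degree_orth_poly)
    next
      case False
      then have "hankel_minor h (Suc j) = 0" by (intro zero) simp
      then obtain q where q: "q \<noteq> 0" "degree q \<le> j" "\<And>s. degree s \<le> j \<Longrightarrow> ?L (q * s) = 0"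
        by (subst (asm) hankel_minor_eq_0_iff) (auto simp: less_Suc_eq_le)
      define u v where "u = q div ?P" and "v = q mod ?P"
      have quv: "q = ?P * u + v" by (simp add: u_def v_def)
      have dv: "v = 0 \<or> degree v < m"
        unfolding v_def using degree_mod_less[of ?P q] by (simp add: degree_orth_poly)
      have du: "m + degree u \<le> j" if "u \<noteq> 0"
      proof -
        have "degree (?P * u) = m + degree u"
          using that by (simp add: degree_mult_eq degree_orth_poly)
        moreover have "degree q = degree (?P * u)"
        proof (cases "v = 0")
          case False
          then show ?thesis using dv \<open>degree (?P * u) = m + degree u\<close>
            unfolding quv by (intro degree_add_eq_left) simp
        qed (simp add: quv)
        ultimately show ?thesis using q(2) by simp
      qed
      \<comment> \<open>Pairing \<open>q\<close> with its own remainder isolates L(v^2): the other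
        term is L(P u v) with \<open>degree (u * v) < j\<close>, hence zero by
        \<open>low\<close>.\<close>
      have "v = 0"
      proof (rule ccontr)
        assume v: "v \<noteq> 0"
        with dv have dvm: "degree v < m" by simp
        have "?L (q * v) = 0" using dvm False by (intro q(3)) simp
        moreover have "q * v = ?P * (u * v) + v * v" by (simp add: quv algebra_simps)
        moreover have "?L (?P * (u * v)) = 0"
        proof (cases "u = 0")
          case False
          then have "degree (u * v) < j" using du v dvm by (simp add: degree_mult_eq)
          then show ?thesis by (rule low)
        qed simp
        ultimately have "?L (v * v) = 0" by (simp add: moment_functional_add)
        with pos_def_belowD[OF pos v dvm] show False by simp
      qed
      then have qu: "q = ?P * u" and u: "u \<noteq> 0" using q(1) quv by auto
      \<comment> \<open>The power \<open>s\<close> lifts \<open>u\<close> to degree exactly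
        \<open>j\<close>. Thus \<open>u * s\<close> is \<open>lead_coeff u\<close> times the
        monomial of degree \<open>j\<close> plus a part \<open>w\<close> covered by
        \<open>low\<close>, and L(q s) = 0 yields the claim for \<open>j\<close>.\<close>
      define s where "s = Polynomial.monom (1::real) (j - degree u)"
      have s0: "s \<noteq> 0" and ds: "degree s = j - degree u" by (simp_all add: s_def degree_monom_eq)
      have duj: "degree u \<le> j" using du[OF u] by simp
      define w where "w = u * s - Polynomial.smult (lead_coeff u) (Polynomial.monom 1 j)"
      have dus: "degree (u * s) = j" using u s0 ds duj by (simp add: degree_mult_eq)
      have lus: "coeff (u * s) j = lead_coeff u"
        using dus lead_coeff_mult[of u s] by (simp add: s_def degree_monom_eq)
      have Lw: "?L (?P * w) = 0"
      proof (cases "w = 0")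
        case False
        have "coeff w k = 0" if "k \<ge> j" for k
          using that dus lus by (cases "k = j") (auto simp: w_def coeff_eq_0)
        then have "degree w < j" using False by (metis leading_coeff_0_iff not_le)
        then show ?thesis by (rule low)
      qed simp
      have "?L (q * s) = 0" using ds by (intro q(3)) simp
      moreover have "q * s = ?P * w + Polynomial.smult (lead_coeff u) (?P * Polynomial.monom 1 j)"
        by (simp add: qu w_def algebra_simps)
      ultimately show ?thesis using Lw u by (simp add: moment_functional_linear)
    qed
  qed
  have "?L (?P * q) = ?L (?P * (\<Sum>i<Suc (degree q). Polynomial.smult (coeff q i) (Polynomial.monom 1 i)))"
    using poly_eq_sum_monom[of q "Suc (degree q)"] by simp
  then show ?thesis
    by (simp add: sum_distrib_left moment_functional_linear mon del: sum.lessThan_Suc)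
qed

lemma pos_def_order_quadrature:
  assumes "pos_def_order (\<lambda>i j. h (i + j)) m"
  obtains X w where "finite X" and "\<And>x. x \<in> X \<Longrightarrow> w x > 0"
    and "\<And>p. moment_functional h p = (\<Sum>x\<in>X. w x * poly p x)"
proof -
  \<comment> \<open>The definition of the order speaks of \<open>n \<ge> 1\<close>; for
    \<open>n = 0\<close> the minor is the empty determinant 1.\<close>
  have "hankel_minor h n > 0" if "n \<le> m" for n
    using assms that by (cases "n = 0") (auto simp: pos_def_order_def hankel_minor_def leading_minor_def)
  then have pos: "pos_def_below h m" by (simp add: pos_def_below_iff_minors)
  interpret quasi_orthogonal h "orth_poly h m" by (rule quasi_orthogonal_orth_poly[OF pos])
  have zero: "hankel_minor h n = 0" if "n > m" for n
    using assms that by (auto simp: pos_def_order_def hankel_minor_def)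
  have "moment_functional h p = (\<Sum>x\<in>nodes. weight x * poly p x)" for p
    by (rule quadrature, rule orth_poly_annihilates[OF pos zero])
  with finite_nodes weight_pos show thesis by (rule that)
qed

section \<open>Measures with prescribed moments\<close>

definition has_moments :: "real measure \<Rightarrow> (nat \<Rightarrow> real) \<Rightarrow> bool" where
  "has_moments M h \<longleftrightarrow> sets M = sets borel \<and> finite_measure M \<and>
     (\<forall>p. integrable M (poly p)) \<and> (\<forall>p. (\<integral>x. poly p x \<partial>M) = moment_functional h p)"

lemma has_momentsD:
  assumes "has_moments M h"
  shows "sets M = sets borel" and "finite_measure M" and "integrable M (poly p)"
    and "(\<integral>x. poly p x \<partial>M) = moment_functional h p"
  using assms by (auto simp: has_moments_def)

lemma has_momentsI:
  assumes "sets M = sets borel" and "finite_measure M"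
    and int: "\<And>k. integrable M (\<lambda>x. x ^ k)" and eq: "\<And>k. (\<integral>x. x ^ k \<partial>M) = h k"
  shows "has_moments M h"
proof -
  have "integrable M (poly p) \<and> (\<integral>x. poly p x \<partial>M) = moment_functional h p" for p
  proof -
    have "poly p = (\<lambda>x. \<Sum>i\<le>degree p. coeff p i * x ^ i)" by (simp add: fun_eq_iff poly_altdef)
    then show ?thesis using int eq by (simp add: moment_functional_def)
  qed
  then show ?thesis using assms by (simp add: has_moments_def)
qed

lemma poly_monom_1: "poly (Polynomial.monom 1 k) = (\<lambda>x :: 'a :: comm_semiring_1. x ^ k)"
  by (simp add: fun_eq_iff poly_monom)

lemma has_moments_integral:
  assumes "sets M = sets borel" and "finite_measure M" and "\<And>p. integrable M (poly p)"
  shows "has_moments M (\<lambda>k. \<integral>x. x ^ k \<partial>M)"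
proof (rule has_momentsI)
  show "integrable M (\<lambda>x. x ^ k)" for k
    using assms(3)[of "Polynomial.monom 1 k"] by (simp add: poly_monom_1)
qed (use assms in auto)

text \<open>The push-forward moves the point masses from the power set of \<open>X\<close>, on which
  \<open>point_measure\<close> lives, to the Borel sets of the line.\<close>

definition atomic_measure :: "real set \<Rightarrow> (real \<Rightarrow> real) \<Rightarrow> real measure" where
  "atomic_measure X w = distr (point_measure X (\<lambda>x. ennreal (w x))) borel (\<lambda>x. x)"

lemma sets_atomic_measure [simp]: "sets (atomic_measure X w) = sets borel"
  by (simp add: atomic_measure_def)

lemma space_atomic_measure [simp]: "space (atomic_measure X w) = UNIV"
  by (simp add: atomic_measure_def)

lemma emeasure_atomic_measure:
  assumes "finite X" and "A \<in> sets borel"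
  shows "emeasure (atomic_measure X w) A = (\<Sum>x\<in>X \<inter> A. ennreal (w x))"
  using assms unfolding atomic_measure_def
  by (subst emeasure_distr) (auto simp: space_point_measure emeasure_point_measure_finite Int_commute)

lemma finite_measure_atomic_measure: "finite X \<Longrightarrow> finite_measure (atomic_measure X w)"
  by (rule finite_measureI) (simp add: emeasure_atomic_measure)

lemma integrable_atomic_measure:
  fixes f :: "real \<Rightarrow> real"
  assumes "finite X" and "f \<in> borel_measurable borel"
  shows "integrable (atomic_measure X w) f"
  unfolding atomic_measure_def using assms
  by (subst integrable_distr_eq) (auto intro: integrable_point_measure_finite)

lemma integral_atomic_measure:
  fixes f :: "real \<Rightarrow> real"
  assumes "finite X" and "\<And>x. x \<in> X \<Longrightarrow> w x \<ge> 0" and "f \<in> borel_measurable borel"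
  shows "(\<integral>x. f x \<partial>atomic_measure X w) = (\<Sum>x\<in>X. w x * f x)"
  unfolding atomic_measure_def using assms
  by (subst integral_distr) (auto simp: lebesgue_integral_point_measure_finite)

text \<open>The complement of the support is the union of all open null sets, and by Lindelof
  countably many of them suffice.\<close>

lemma complement_support_null:
  assumes sets: "sets M = sets borel"
  shows "- measure_support M \<in> null_sets M"
proof -
  define F where "F = {S. open S \<and> emeasure M S = 0}"
  have "- measure_support M = \<Union>F"
    by (auto simp: measure_support_def F_def)
  moreover obtain F' where F': "F' \<subseteq> F" "countable F'" "\<Union>F' = \<Union>F"
    using Lindelof[of F] by (auto simp: F_def)
  moreover have "(\<Union>S\<in>F'. S) \<in> null_sets M"
    using F' by (intro null_sets_UN') (auto simp: F_def null_sets_def sets)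
  ultimately show ?thesis by simp
qed

text \<open>A vanishing integral would make the open set where \<open>q\<close> is nonzero a null
  set, although it contains a point of the support.\<close>

lemma integral_square_pos:
  assumes sets: "sets M = sets borel" and int: "integrable M (poly (q * q))"
    and x: "x \<in> measure_support M" "poly q x \<noteq> 0"
  shows "(\<integral>x. poly (q * q) x \<partial>M) > 0"
proof -
  have "(\<integral>x. poly (q * q) x \<partial>M) \<noteq> 0"
  proof
    assume "(\<integral>x. poly (q * q) x \<partial>M) = 0"
    then have AE: "AE x in M. poly (q * q) x = 0"
      by (subst (asm) integral_nonneg_eq_0_iff_AE[OF int]) auto
    have op: "open {x. poly q x \<noteq> 0}"
      by (intro open_Collect_neq continuous_intros)
    have "{x. poly q x \<noteq> 0} \<in> null_sets M"
      using AE op by (subst (asm) AE_iff_null) (auto simp: sets sets_eq_imp_space_eq[OF sets])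
    with op x show False
      by (auto simp: measure_support_def null_sets_def)
  qed
  moreover have "(\<integral>x. poly (q * q) x \<partial>M) \<ge> 0" by (rule Bochner_Integration.integral_nonneg) simp
  ultimately show ?thesis by linarith
qed

text \<open>A nonzero polynomial of degree below \<open>n\<close> has fewer than \<open>n\<close>
  roots, so it cannot vanish on the whole support.\<close>

lemma pos_def_below_support:
  assumes M: "has_moments M h" and "infinite (measure_support M) \<or> n \<le> card (measure_support M)"
  shows "pos_def_below h n"
  unfolding pos_def_below_def
proof (intro allI impI, elim conjE)
  fix q :: "real poly" assume q: "q \<noteq> 0" "degree q < n"
  have "\<exists>x\<in>measure_support M. poly q x \<noteq> 0"
  proof (rule ccontr)
    assume "\<not> (\<exists>x\<in>measure_support M. poly q x \<noteq> 0)"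
    then have sub: "measure_support M \<subseteq> {x. poly q x = 0}" by auto
    moreover have fin: "finite {x. poly q x = 0}" by (rule poly_roots_finite[OF q(1)])
    ultimately have "finite (measure_support M)" by (rule finite_subset)
    with assms(2) have "n \<le> card (measure_support M)" by simp
    also have "\<dots> \<le> card {x. poly q x = 0}" by (rule card_mono[OF fin sub])
    also have "\<dots> \<le> degree q" by (rule card_poly_roots_bound[OF q(1)])
    finally show False using q(2) by simp
  qed
  then show "moment_functional h (q * q) > 0"
    using integral_square_pos[of M q] has_momentsD[OF M] by metis
qed

lemma leading_minor_hankel: "leading_minor (\<lambda>i j. h (i + j)) n = hankel_minor h n"
  by (simp add: hankel_minor_def)

lemma pos_def_infinite_iff: "pos_def_infinite (\<lambda>i j. h (i + j)) \<longleftrightarrow> (\<forall>n. pos_def_below h n)"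
proof -
  have "hankel_minor h 0 > 0" by (simp add: hankel_minor_def leading_minor_def)
  then show ?thesis
    unfolding pos_def_infinite_def leading_minor_hankel pos_def_below_iff_minors
    by (metis One_nat_def Suc_leI le_refl neq0_conv)
qed

text \<open>The order is the number of support points: beyond it, the monic polynomial whose simple
  roots are these points lies in the kernel of the form.\<close>

lemma pos_def_order_support:
  assumes M: "has_moments M h" and fin: "finite (measure_support M)"
  shows "pos_def_order (\<lambda>i j. h (i + j)) (card (measure_support M))"
proof -
  let ?S = "measure_support M"
  have "pos_def_below h (card ?S)" by (rule pos_def_below_support[OF M]) simp
  then have "hankel_minor h n > 0" if "n \<le> card ?S" for n
    using that by (simp add: pos_def_below_iff_minors)
  moreover have "hankel_minor h n = 0" if n: "n > card ?S" for n
  proof -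
    define q where "q = (\<Prod>x\<in>?S. [:- x, 1:])"
    have "moment_functional h (q * s) = 0" for s
    proof -
      have "poly (q * s) x = 0" if "x \<in> ?S" for x
        using that fin by (auto simp: q_def poly_prod)
      then have "AE x in M. poly (q * s) x = 0"
        by (intro AE_I'[OF complement_support_null[OF has_momentsD(1)[OF M]]]) auto
      then have "(\<integral>x. poly (q * s) x \<partial>M) = 0" by (rule integral_eq_zero_AE)
      then show ?thesis by (simp only: has_momentsD(4)[OF M])
    qed
    moreover have "q \<noteq> 0" using fin by (simp add: q_def)
    moreover have "degree q < n" using n by (simp add: q_def degree_root_product)
    ultimately show ?thesis using hankel_minor_eq_0_iff[of n h] n by auto
  qed
  ultimately show ?thesis by (auto simp: pos_def_order_def leading_minor_hankel)
qed

lemma pos_def_order_imp_measure: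
  assumes "pos_def_order (\<lambda>i j. h (i + j)) m"
  obtains M where "has_moments M h" and "finite (measure_support M)"
proof -
  obtain X w where X: "finite X" "\<And>x. x \<in> X \<Longrightarrow> w x > 0"
    and L: "\<And>p. moment_functional h p = (\<Sum>x\<in>X. w x * poly p x)"
    using pos_def_order_quadrature[OF assms] by blast
  let ?M = "atomic_measure X w"
  have meas: "poly p \<in> borel_measurable borel" for p :: "real poly"
    by (intro borel_measurable_continuous_onI continuous_intros)
  have "has_moments ?M h"
    unfolding has_moments_def using X meas
    by (simp add: finite_measure_atomic_measure integrable_atomic_measure integral_atomic_measure L less_imp_le)
  moreover have "measure_support ?M \<subseteq> X"
  proof
    fix x assume x: "x \<in> measure_support ?M"
    have op: "open (- X)" using X(1) by (simp add: finite_imp_closed open_Compl)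
    then have "emeasure ?M (- X) = 0"
      using X(1) by (subst emeasure_atomic_measure) auto
    with op x show "x \<in> X" unfolding measure_support_def by force
  qed
  then have "finite (measure_support ?M)" using X(1) finite_subset by blast
  ultimately show thesis by (rule that)
qed

section \<open>Truncated moments and the Hamburger moment problem\<close>

lemma power_clamp_bound:
  fixes x R :: real
  assumes "R > 0"
  shows "\<bar>x ^ k - (max (- R) (min x R)) ^ k\<bar> \<le> 2 / R ^ k * x ^ (2 * k)"
proof (cases "\<bar>x\<bar> \<le> R")
  case True
  then have "max (- R) (min x R) = x" by auto
  then show ?thesis using assms by simp
next
  case False
  have "\<bar>max (- R) (min x R)\<bar> \<le> \<bar>x\<bar>" using False assms by auto
  then have "\<bar>(max (- R) (min x R)) ^ k\<bar> \<le> \<bar>x\<bar> ^ k"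
    by (simp add: power_abs power_mono)
  then have "\<bar>x ^ k - (max (- R) (min x R)) ^ k\<bar> \<le> 2 * \<bar>x\<bar> ^ k"
    by (simp add: power_abs[symmetric])
  \<comment> \<open>Outside the interval from -R to R the factor
    \<open>\<bar>x\<bar> ^ k / R ^ k\<close> is at least 1.\<close>
  also have "\<dots> \<le> 2 / R ^ k * x ^ (2 * k)"
  proof -
    have "R ^ k * \<bar>x\<bar> ^ k \<le> \<bar>x\<bar> ^ k * \<bar>x\<bar> ^ k"
      using False assms by (intro mult_right_mono power_mono) auto
    also have "\<dots> = x ^ (2 * k)"
      by (metis abs_mult_self_eq power_mult_distrib power2_eq_square power_mult)
    finally show ?thesis using assms by (simp add: field_simps)
  qed
  finally show ?thesis .
qed

text \<open>Clamping to the interval from -R to R changes the moment of order \<open>k\<close> by an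
  amount controlled by \<open>R\<close> and the moment of order \<open>2 * k\<close> alone. This is
  uniform over the approximating measures and applies to their weak limit as well.\<close>

lemma moment_clamp_bound:
  fixes R :: real
  assumes M: "finite_measure M" "sets M = sets borel" and int: "\<And>j. integrable M (\<lambda>x. x ^ j)"
    and B: "(\<integral>x. x ^ (2 * k) \<partial>M) \<le> B" and R: "R > 0"
  shows "\<bar>(\<integral>x. x ^ k \<partial>M) - (\<integral>x. (max (- R) (min x R)) ^ k \<partial>M)\<bar> \<le> 2 / R ^ k * B"
proof -
  interpret finite_measure M by fact
  have [measurable_cong]: "sets M = sets borel" by fact
  have int': "integrable M (\<lambda>x. (max (- R) (min x R)) ^ k)"
  proof (rule integrable_const_bound[where B = "R ^ k"])
    have "\<bar>max (- R) (min x R)\<bar> \<le> R" for x using R by auto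
    then show "AE x in M. norm ((max (- R) (min x R)) ^ k) \<le> R ^ k"
      by (simp add: power_abs power_mono)
  qed measurable
  have "\<bar>(\<integral>x. x ^ k \<partial>M) - (\<integral>x. (max (- R) (min x R)) ^ k \<partial>M)\<bar>
      = \<bar>\<integral>x. x ^ k - (max (- R) (min x R)) ^ k \<partial>M\<bar>"
    using int int' by simp
  also have "\<dots> \<le> (\<integral>x. \<bar>x ^ k - (max (- R) (min x R)) ^ k\<bar> \<partial>M)"
    by (rule integral_abs_bound)
  also have "\<dots> \<le> (\<integral>x. 2 / R ^ k * x ^ (2 * k) \<partial>M)"
    using int int' power_clamp_bound[OF R] by (intro integral_mono) auto
  also have "\<dots> = 2 / R ^ k * (\<integral>x. x ^ (2 * k) \<partial>M)" by simp
  also have "\<dots> \<le> 2 / R ^ k * B" using B R by (intro mult_left_mono) auto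
  finally show ?thesis .
qed

text \<open>The second moments give tightness, and the moments of order \<open>2k\<close> give the uniform
  integrability needed to pass to the limit in the moment of order \<open>k\<close>.\<close>

lemma hamburger_limit:
  fixes s :: "nat \<Rightarrow> real"
  assumes prob: "\<And>n. real_distribution (\<nu> n)"
    and int: "\<And>n k. integrable (\<nu> n) (\<lambda>x. x ^ k)"
    and mom: "\<And>n k. k \<le> n + 2 \<Longrightarrow> (\<integral>x. x ^ k \<partial>\<nu> n) = s k"
  obtains M where "has_moments M s"
proof -
  have "tight \<nu>"
    unfolding tight_def
  proof (intro conjI allI impI)
    fix \<epsilon> :: real assume \<epsilon>: "\<epsilon> > 0"
    have s2: "s 2 \<ge> 0" 
      using mom[of 2 0] Bochner_Integration.integral_nonneg[of "\<nu> 0" "\<lambda>x. x\<^sup>2"] by simp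
    \<comment> \<open>Chebyshev's inequality is used with the common second moment
      \<open>s 2\<close>, available from \<open>\<nu> 0\<close> on because moments agree for
      \<open>k \<le> n + 2\<close>. The summand 1 gives \<open>a > 0\<close> and a strict inequality
      even if \<open>s 2 = 0\<close>.\<close>
    define a where "a = sqrt (s 2 / \<epsilon>) + 1"
    have a: "a > 0" unfolding a_def using s2 \<epsilon> by (simp add: add_nonneg_pos)
    have "s 2 / \<epsilon> < a\<^sup>2"
    proof -
      have "s 2 / \<epsilon> = (sqrt (s 2 / \<epsilon>))\<^sup>2" using s2 \<epsilon> by simp
      also have "\<dots> < a\<^sup>2" unfolding a_def using s2 \<epsilon> by (intro power_strict_mono) auto
      finally show ?thesis .
    qed
    then have small: "s 2 / a\<^sup>2 < \<epsilon>" using a \<epsilon> by (simp add: field_simps)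
    have "measure (\<nu> n) {- a<..a} > 1 - \<epsilon>" for n
    proof -
      interpret real_distribution "\<nu> n" by (rule prob)
      have "measure (\<nu> n) {x \<in> space (\<nu> n). x\<^sup>2 \<ge> a\<^sup>2} \<le> (\<integral>x. x\<^sup>2 \<partial>\<nu> n) / a\<^sup>2"
        by (rule integral_Markov_inequality_measure[where A = "{}"]) (use int[of n 2] a in auto)
      also have "\<dots> < \<epsilon>" using mom[of 2 n] small by simp
      finally have tail: "prob {x. x\<^sup>2 \<ge> a\<^sup>2} < \<epsilon>" by simp
      have "- {x. x\<^sup>2 \<ge> a\<^sup>2} \<subseteq> {- a<..a}"
      proof
        fix x assume "x \<in> - {x. x\<^sup>2 \<ge> a\<^sup>2}"
        then have "\<bar>x\<bar> < \<bar>a\<bar>" using abs_le_square_iff[of a x] by auto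
        then show "x \<in> {- a<..a}" using a by auto
      qed
      then have "prob (- {x. x\<^sup>2 \<ge> a\<^sup>2}) \<le> prob {- a<..a}"
        by (intro finite_measure_mono) auto
      moreover have "prob (- {x. x\<^sup>2 \<ge> a\<^sup>2}) = 1 - prob {x. x\<^sup>2 \<ge> a\<^sup>2}"
        using prob_compl[of "{x. x\<^sup>2 \<ge> a\<^sup>2}"] by (simp add: Compl_eq_Diff_UNIV)
      ultimately show ?thesis using tail by simp
    qed
    then show "\<exists>a b. a < b \<and> (\<forall>n. measure (\<nu> n) {a<..b} > 1 - \<epsilon>)"
      using a by (intro exI[of _ "- a"] exI[of _ a]) auto
  qed (rule prob)
  from tight_imp_convergent_subsubsequence[OF this strict_mono_id]
  obtain r M where r: "strict_mono (r :: nat \<Rightarrow> nat)" and M: "real_distribution M"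
    and conv: "weak_conv_m (\<nu> \<circ> id \<circ> r) M" by blast
  define \<rho> where "\<rho> n = \<nu> (r n)" for n
  have \<rho>: "real_distribution (\<rho> n)" "integrable (\<rho> n) (\<lambda>x. x ^ k)" for n k
    using prob int by (simp_all add: \<rho>_def)
  have mom_\<rho>: "(\<integral>x. x ^ k \<partial>\<rho> n) = s k" if "k \<le> n" for k n
    unfolding \<rho>_def by (rule mom) (use that seq_suble[OF r, of n] in linarith)
  have "\<rho> = \<nu> \<circ> id \<circ> r" by (simp add: fun_eq_iff \<rho>_def)
  with conv have conv: "weak_conv_m \<rho> M" by simp
  interpret real_distribution M by fact
  have lim: "(\<lambda>n. \<integral>x. f x \<partial>\<rho> n) \<longlonglongrightarrow> (\<integral>x. f x \<partial>M)"
    if "\<And>x. isCont f x" "\<And>x. \<bar>f x\<bar> \<le> B" for f :: "real \<Rightarrow> real" and B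
    using weak_conv_imp_integral_bdd_continuous_conv[OF \<rho>(1) M conv that(1), of B] that(2) by simp
  \<comment> \<open>Weak convergence handles bounded continuous functions only, so x^(2k) is cut off
    at height \<open>R\<close>. Monotone convergence in \<open>R\<close> then gives finiteness and
    an inequality; equality needs the clamping estimate.\<close>
  have even: "integrable M (\<lambda>x. x ^ (2 * k)) \<and> (\<integral>x. x ^ (2 * k) \<partial>M) \<le> s (2 * k)" for k
  proof -
    have s: "s (2 * k) \<ge> 0"
      unfolding mom_\<rho>[OF order_refl, symmetric] by (intro Bochner_Integration.integral_nonneg) (simp add: power_mult)
    define f where "f R x = min (x ^ (2 * k)) (real R)" for R and x :: real
    have f0: "0 \<le> f R x" for R x by (simp add: f_def power_mult)
    have fR: "\<bar>f R x\<bar> \<le> real R" for R x using f0[of R x] by (simp add: f_def)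
    have [measurable]: "f R \<in> borel_measurable borel" for R unfolding f_def by measurable
    have "(\<integral>x. f R x \<partial>M) \<le> s (2 * k)" for R
    proof (rule LIMSEQ_le_const2[OF lim[of "f R", OF _ fR]])
      show "isCont (f R) x" for x unfolding f_def by (intro continuous_intros)
      have "(\<integral>x. f R x \<partial>\<rho> n) \<le> s (2 * k)" if "n \<ge> 2 * k" for n
      proof -
        interpret \<rho>n: real_distribution "\<rho> n" by (rule \<rho>)
        have "integrable (\<rho> n) (f R)"
          using fR by (intro \<rho>n.integrable_const_bound[where B = "real R"]) auto
        then have "(\<integral>x. f R x \<partial>\<rho> n) \<le> (\<integral>x. x ^ (2 * k) \<partial>\<rho> n)"
          by (rule integral_mono[OF _ \<rho>(2)]) (simp add: f_def)
        then show ?thesis using mom_\<rho>[OF that] by simp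
      qed
      then show "\<exists>N. \<forall>n\<ge>N. (\<integral>x. f R x \<partial>\<rho> n) \<le> s (2 * k)" by blast
    qed
    moreover have "integrable M (f R)" for R
      using fR by (intro integrable_const_bound[where B = "real R"]) auto
    ultimately have nn: "(\<integral>\<^sup>+x. ennreal (f R x) \<partial>M) \<le> ennreal (s (2 * k))" for R
      using f0 by (subst nn_integral_eq_integral) (auto intro: ennreal_leI)
    have "ennreal (x ^ (2 * k)) = (SUP R. ennreal (f R x))" for x :: real
    proof (rule antisym)
      obtain R where "x ^ (2 * k) \<le> real R" using real_arch_simple by blast
      then have "ennreal (x ^ (2 * k)) = ennreal (f R x)" by (simp add: f_def)
      also have "\<dots> \<le> (SUP R. ennreal (f R x))" by (rule SUP_upper) simp
      finally show "ennreal (x ^ (2 * k)) \<le> (SUP R. ennreal (f R x))" .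
    qed (auto intro!: SUP_least ennreal_leI simp: f_def)
    then have "(\<integral>\<^sup>+x. ennreal (x ^ (2 * k)) \<partial>M) = (\<integral>\<^sup>+x. (SUP R. ennreal (f R x)) \<partial>M)" by simp
    also have "\<dots> = (SUP R. \<integral>\<^sup>+x. ennreal (f R x) \<partial>M)"
      by (rule nn_integral_monotone_convergence_SUP)
         (auto simp: incseq_def le_fun_def f_def intro!: ennreal_leI)
    also have "\<dots> \<le> ennreal (s (2 * k))" using nn by (intro SUP_least)
    finally have le: "(\<integral>\<^sup>+x. ennreal (x ^ (2 * k)) \<partial>M) \<le> ennreal (s (2 * k))" .
    have nonneg: "0 \<le> x ^ (2 * k)" for x :: real by (simp add: power_mult)
    have "integrable M (\<lambda>x. x ^ (2 * k))"
      by (rule integrableI_nonneg) (use le nonneg in \<open>auto intro: le_less_trans\<close>)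
    moreover from this have "(\<integral>x. x ^ (2 * k) \<partial>M) \<le> s (2 * k)"
      using le nonneg s by (subst (asm) nn_integral_eq_integral) auto
    ultimately show ?thesis by simp
  qed
  have intM: "integrable M (\<lambda>x. x ^ k)" for k
  proof (rule Bochner_Integration.integrable_bound)
    show "integrable M (\<lambda>x. 1 + x ^ (2 * k))" using even[of k] by simp
    show "AE x in M. norm (x ^ k) \<le> norm (1 + x ^ (2 * k))"
    proof (intro AE_I2)
      fix x :: real
      have "0 \<le> (\<bar>x ^ k\<bar> - 1)\<^sup>2 + \<bar>x ^ k\<bar>" by simp
      then have "\<bar>x ^ k\<bar> \<le> 1 + (x ^ k)\<^sup>2" by (simp add: power2_diff)
      then show "norm (x ^ k) \<le> norm (1 + x ^ (2 * k))"
        by (simp add: power_mult[symmetric] mult.commute)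
    qed
  qed measurable
  have momM: "(\<integral>x. x ^ k \<partial>M) = s k" for k
  \<comment> \<open>For \<open>k = 0\<close> the error bound does not decay in \<open>R\<close>;
    there the claim is that all measures have total mass 1.\<close>
  proof (cases "k = 0")
    case True
    then show ?thesis using mom_\<rho>[of 0 0] prob_space.prob_space[OF real_distribution.axioms(1)[OF \<rho>(1)[of 0]]]
      real_distribution.space_eq_univ[OF \<rho>(1)[of 0]] prob_space by simp
  next
    case False
    \<comment> \<open>The constant 4 is 2 + 2: one clamping error for the approximating measures,
      kept in the limit, and one for \<open>M\<close>.\<close>
    have est: "\<bar>(\<integral>x. x ^ k \<partial>M) - s k\<bar> \<le> 4 / R ^ k * s (2 * k)" if R: "R > 0" for R :: real
    proof -
      let ?g = "\<lambda>x. (max (- R) (min x R)) ^ k"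
      have "(\<lambda>n. \<integral>x. ?g x \<partial>\<rho> n) \<longlonglongrightarrow> (\<integral>x. ?g x \<partial>M)"
      proof (rule lim)
        show "isCont ?g x" for x by (intro continuous_intros)
        have "\<bar>max (- R) (min x R)\<bar> \<le> R" for x using R by auto
        then show "\<bar>?g x\<bar> \<le> R ^ k" for x by (simp add: power_abs power_mono)
      qed
      then have "(\<lambda>n. \<bar>s k - (\<integral>x. ?g x \<partial>\<rho> n)\<bar>) \<longlonglongrightarrow> \<bar>s k - (\<integral>x. ?g x \<partial>M)\<bar>"
        by (intro tendsto_intros)
      moreover have "\<bar>s k - (\<integral>x. ?g x \<partial>\<rho> n)\<bar> \<le> 2 / R ^ k * s (2 * k)" if "n \<ge> 2 * k" for n
      proof -
        interpret \<rho>n: real_distribution "\<rho> n" by (rule \<rho>)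
        have "\<bar>(\<integral>x. x ^ k \<partial>\<rho> n) - (\<integral>x. ?g x \<partial>\<rho> n)\<bar> \<le> 2 / R ^ k * s (2 * k)"
          by (rule moment_clamp_bound) (use \<rho> R mom_\<rho>[OF that] in \<open>auto intro: \<rho>n.finite_measure_axioms\<close>)
        then show ?thesis using mom_\<rho>[of k n] that by simp
      qed
      ultimately have "\<bar>s k - (\<integral>x. ?g x \<partial>M)\<bar> \<le> 2 / R ^ k * s (2 * k)"
        by (intro LIMSEQ_le_const2) auto
      moreover have "\<bar>(\<integral>x. x ^ k \<partial>M) - (\<integral>x. ?g x \<partial>M)\<bar> \<le> 2 / R ^ k * s (2 * k)"
        by (rule moment_clamp_bound) (use intM R even[of k] in \<open>auto intro: finite_measure_axioms\<close>)
      ultimately show ?thesis by (simp add: field_simps)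
    qed
    have "((\<lambda>R :: real. 4 / R ^ k * s (2 * k)) \<longlongrightarrow> 0 * s (2 * k)) at_top"
      using False
      by (intro tendsto_mult tendsto_const tendsto_divide_0[OF tendsto_const]
          filterlim_at_top_imp_at_infinity filterlim_pow_at_top filterlim_ident) auto
    moreover have "eventually (\<lambda>R. \<bar>(\<integral>x. x ^ k \<partial>M) - s k\<bar> \<le> 4 / R ^ k * s (2 * k)) at_top"
      using eventually_gt_at_top[of "0 :: real"] by eventually_elim (rule est)
    ultimately have "\<bar>(\<integral>x. x ^ k \<partial>M) - s k\<bar> \<le> 0 * s (2 * k)"
      by (rule tendsto_lowerbound) simp
    then show ?thesis by simp
  qed
  have "has_moments M s"
    by (rule has_momentsI) (use intM momM finite_measure_axioms in auto)
  then show thesis by (rule that)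
qed

theorem hamburger:
  assumes pos: "\<And>n. pos_def_below h n"
  obtains M where "has_moments M h"
proof -
  have h0: "h 0 > 0"
    using pos_def_belowD[OF pos, of 1 1] by (simp add: moment_functional_def)
  \<comment> \<open>Quadrature with \<open>n + 2\<close> nodes is exact for degrees below
    \<open>2 * (n + 2)\<close>, hence for the moments \<open>k \<le> n + 2\<close> that the limit
    lemma asks for. Division by \<open>h 0\<close> makes the measures probabilities; the density
    \<open>h 0\<close> undoes it at the end.\<close>
  define X w where "X n = quasi_orthogonal.nodes (orth_poly h (n + 2))"
    and "w n x = quasi_orthogonal.weight h (orth_poly h (n + 2)) x / h 0" for n x
  have X: "finite (X n)" and w: "x \<in> X n \<Longrightarrow> w n x \<ge> 0"
    and L: "degree p < 2 * (n + 2) \<Longrightarrow> moment_functional h p / h 0 = (\<Sum>x\<in>X n. w n x * poly p x)" for n x p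
  proof -
    interpret quasi_orthogonal h "orth_poly h (n + 2)" by (rule quasi_orthogonal_orth_poly[OF pos])
    show "finite (X n)" unfolding X_def by (rule finite_nodes)
    show "x \<in> X n \<Longrightarrow> w n x \<ge> 0" using weight_pos h0 by (simp add: X_def w_def less_imp_le)
    show "degree p < 2 * (n + 2) \<Longrightarrow> moment_functional h p / h 0 = (\<Sum>x\<in>X n. w n x * poly p x)"
      using quadrature_degree[of p] by (simp add: degree_orth_poly X_def w_def sum_divide_distrib)
  qed
  define \<nu> where "\<nu> n = atomic_measure (X n) (w n)" for n
  have mom: "(\<integral>x. x ^ k \<partial>\<nu> n) = h k / h 0" if "k \<le> n + 2" for k n
  proof -
    have "(\<integral>x. x ^ k \<partial>\<nu> n) = (\<Sum>x\<in>X n. w n x * x ^ k)"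
      unfolding \<nu>_def using X w by (intro integral_atomic_measure) auto
    also have "\<dots> = moment_functional h (Polynomial.monom 1 k) / h 0"
      using that by (subst L[of _ n]) (auto simp: degree_monom_eq poly_monom)
    finally show ?thesis by (simp add: moment_functional_monom)
  qed
  have "real_distribution (\<nu> n)" for n
  proof -
    interpret finite_measure "\<nu> n" unfolding \<nu>_def by (rule finite_measure_atomic_measure[OF X])
    have "measure (\<nu> n) (space (\<nu> n)) = 1" using mom[of 0 n] h0 by simp
    then have "prob_space (\<nu> n)" by (intro prob_spaceI) (simp add: emeasure_eq_measure)
    then show ?thesis by (simp add: real_distribution_def real_distribution_axioms_def \<nu>_def)
  qed
  moreover have "integrable (\<nu> n) (\<lambda>x. x ^ k)" for n k
    unfolding \<nu>_def by (rule integrable_atomic_measure[OF X]) measurable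
  ultimately obtain M where M: "has_moments M (\<lambda>k. h k / h 0)"
    using hamburger_limit[of \<nu> "\<lambda>k. h k / h 0"] mom by blast
  note MD = has_momentsD[OF M]
  interpret finite_measure M by (rule MD)
  have [measurable_cong]: "sets M = sets borel" by (rule MD)
  define N where "N = density M (\<lambda>_. ennreal (h 0))"
  have intM: "integrable M (\<lambda>x. x ^ k)" for k
    using MD(3)[of "Polynomial.monom 1 k"] by (simp add: poly_monom_1)
  have "has_moments N h"
  proof (rule has_momentsI)
    show "sets N = sets borel" by (simp add: N_def MD)
    show "finite_measure N"
      by (rule finite_measureI) (simp add: N_def emeasure_density nn_integral_cmult_indicator ennreal_mult_eq_top_iff)
    show "integrable N (\<lambda>x. x ^ k)" for k
      unfolding N_def using h0 intM by (subst integrable_density) auto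
    show "(\<integral>x. x ^ k \<partial>N) = h k" for k
      unfolding N_def using h0 MD(4)[of "Polynomial.monom 1 k"]
      by (subst integral_density) (auto simp: poly_monom moment_functional_monom)
  qed
  then show thesis by (rule that)
qed

lemma pos_def_infinite_imp_measure:
  assumes "pos_def_infinite (\<lambda>i j. h (i + j))"
  obtains M where "has_moments M h" and "infinite (measure_support M)"
proof -
  have pos: "pos_def_below h n" for n using assms by (simp add: pos_def_infinite_iff)
  obtain M where M: "has_moments M h" using hamburger[OF pos] by blast
  have "infinite (measure_support M)"
  proof
    assume "finite (measure_support M)"
    then have "hankel_minor h (Suc (card (measure_support M))) = 0"
      using pos_def_order_support[OF M] by (simp add: pos_def_order_def leading_minor_hankel)
    moreover have "hankel_minor h (Suc (card (measure_support M))) > 0"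
      using pos[unfolded pos_def_below_iff_minors] by blast
    ultimately show False by simp
  qed
  with M show thesis by (rule that)
qed

section \<open>Hankel--Sobolev matrices\<close>

lemma inf_mult_single_left:
  assumes "\<And>k. k \<noteq> a \<Longrightarrow> A i k = 0"
  shows "(A \<star> B) i j = A i a * B a j"
  unfolding inf_mult_def using assms by (subst suminf_finite[of "{a}"]) auto

lemma inf_mult_single_right:
  assumes "\<And>k. k \<noteq> a \<Longrightarrow> B k j = 0"
  shows "(A \<star> B) i j = A i a * B a j"
  unfolding inf_mult_def using assms by (subst suminf_finite[of "{a}"]) auto

lemma U_pow_entry: "U_pow m i j = (if j = i + m then 1 else 0)"
proof (induction m arbitrary: i)
  case (Suc m)
  have "U_pow (Suc m) i j = U_pow m (Suc i) j"
    unfolding U_pow_def inf_power.simps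
    by (subst inf_mult_single_left[of "Suc i"]) (auto simp: shift_mat_def)
  then show ?case using Suc by simp
qed (simp add: U_pow_def inf_unit_def)

lemma U_neg_pow_entry: "U_neg_pow m i j = (if i = j + m then 1 else 0)"
proof (induction m arbitrary: i)
  case (Suc m)
  show ?case
  proof (cases i)
    case 0
    have "U_neg_pow (Suc m) i j = 0"
      unfolding U_neg_pow_def inf_power.simps
      by (subst inf_mult_single_left[of 0]) (auto simp: shift_mat_def inf_transpose_def 0)
    then show ?thesis using 0 by simp
  next
    case (Suc i')
    have "U_neg_pow (Suc m) i j = U_neg_pow m i' j"
      unfolding U_neg_pow_def inf_power.simps
      by (subst inf_mult_single_left[of i']) (auto simp: shift_mat_def inf_transpose_def Suc)
    then show ?thesis using Suc.IH Suc by simp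
  qed
qed (simp add: U_neg_pow_def inf_unit_def)

lemma U_pow_mult: "(U_pow m \<star> A) i j = A (i + m) j"
  by (subst inf_mult_single_left[of "i + m"]) (simp_all add: U_pow_entry)

lemma mult_U_neg_pow: "(A \<star> U_neg_pow m) i j = A i (j + m)"
  by (subst inf_mult_single_right[of "j + m"]) (simp_all add: U_neg_pow_entry)

lemma U_neg_pow_mult: "(U_neg_pow m \<star> A) i j = (if m \<le> i then A (i - m) j else 0)"
  by (subst inf_mult_single_left[of "i - m"]) (auto simp: U_neg_pow_entry)

lemma mult_U_pow: "(A \<star> U_pow m) i j = (if m \<le> j then A i (j - m) else 0)"
  by (subst inf_mult_single_right[of "j - m"]) (auto simp: U_pow_entry)

lemma mult_D_mat: "(A \<star> D_mat k) i j = A i j * (fact (k + j) / fact j)"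
  by (subst inf_mult_single_right[of j]) (auto simp: D_mat_def)

lemma U_neg_pow_D_mat_mult:
  "(U_neg_pow m \<star> D_mat k \<star> A) i j = (if m \<le> i then fact (k + (i - m)) / fact (i - m) * A (i - m) j else 0)"
  by (subst inf_mult_single_left[of "i - m"]) (auto simp: U_neg_pow_mult D_mat_def)

text \<open>The falling factorial x (x - 1) ... (x - k + 1). Its value at n is the factor produced
  by differentiating x^n \<open>k\<close> times, and also the diagonal entry of
  \<open>D_mat k\<close> at n - k.\<close>

definition falling_fact_poly :: "nat \<Rightarrow> real poly" where
  "falling_fact_poly k = (\<Prod>t<k. [:- real t, 1:])"

lemma falling_fact_poly_Suc:
  "poly (falling_fact_poly (Suc k)) x = poly (falling_fact_poly k) x * (x - real k)"
  by (simp add: falling_fact_poly_def algebra_simps)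

lemma poly_falling_fact_poly:
  "poly (falling_fact_poly k) (real n) = (if k \<le> n then fact n / fact (n - k) else 0)"
proof (induction k)
  case (Suc k)
  show ?case
  proof (cases "k < n")
    case True
    then have "n - k = Suc (n - Suc k)" by simp
    then have "fact (n - k) = real (n - k) * fact (n - Suc k)" by (metis fact_Suc)
    moreover have "real (n - k) \<noteq> 0" using True by simp
    moreover have "real n - real k = real (n - k)" using True by simp
    ultimately have "poly (falling_fact_poly (Suc k)) (real n) = fact n / fact (n - Suc k)"
      unfolding falling_fact_poly_Suc Suc.IH using True by (simp del: of_nat_diff)
    then show ?thesis using True by simp
  qed (use Suc in \<open>auto simp: falling_fact_poly_Suc\<close>)
qed (simp add: falling_fact_poly_def)

lemma degree_falling_fact_poly: "degree (falling_fact_poly k) = k"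
  unfolding falling_fact_poly_def by (subst degree_prod_sum_eq) auto

lemma coeff_falling_fact_poly: "coeff (falling_fact_poly k) k = 1"
proof -
  have "lead_coeff (falling_fact_poly k) = 1"
    unfolding falling_fact_poly_def by (simp add: lead_coeff_prod)
  then show ?thesis by (simp add: degree_falling_fact_poly)
qed

text \<open>The zero rows and columns created by the shifts for \<open>i < k\<close> or
  \<open>j < k\<close> are encoded by zeros of the falling factorials, so the truncated subtraction
  in the index of \<open>H\<close> is harmless.\<close>

lemma sobolev_term_entry:
  "sobolev_term k H i j =
     poly (falling_fact_poly k) (real i) * poly (falling_fact_poly k) (real j) * H (i - k) (j - k)"
  by (simp add: sobolev_term_def mult_U_pow mult_D_mat U_neg_pow_D_mat_mult
      poly_falling_fact_poly)

lemma Phi_entry: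
  "Phi A \<eta> i j = (\<Sum>l\<le>\<eta>. (-1) ^ l * real (\<eta> choose l) * A (i + (\<eta> - l)) (j + l))"
  by (simp add: Phi_def mult_U_neg_pow U_pow_mult)

section \<open>Finite differences and the recovery of the Hankel components\<close>

lemma finite_difference_monomial:
  assumes "m \<le> n"
  shows "(\<Sum>l\<le>n. (-1) ^ l * real (n choose l) * real l ^ m) = (if m = n then (-1) ^ n * fact n else 0)"
  using assms
proof (induction n arbitrary: m)
  case (Suc n)
  show ?case
  proof (cases m)
    case 0
    have "(\<Sum>l\<le>Suc n. (-1) ^ l * real (Suc n choose l)) = 0"
      using choose_alternating_sum[of "Suc n", where 'a = real] by simp
    then show ?thesis using 0 by simp
  next
    case (Suc m')
    have m': "m' \<le> n" using Suc Suc.prems by simp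
    \<comment> \<open>The absorption identity lowers the order of the difference and the exponent
      together. Expanding the power of \<open>Suc l\<close> by the binomial theorem then leaves
      exponents covered by the induction hypothesis.\<close>
    have absorb: "real (Suc n choose Suc l) * real (Suc l) = real (Suc n) * real (n choose l)" for l
      using Suc_times_binomial[of l n] by (metis mult.commute of_nat_mult)
    have "(\<Sum>l\<le>Suc n. (-1) ^ l * real (Suc n choose l) * real l ^ m)
        = (\<Sum>l\<le>n. (-1) ^ Suc l * real (Suc n choose Suc l) * real (Suc l) ^ Suc m')"
      unfolding Suc by (subst sum.atMost_Suc_shift) simp
    also have "\<dots> = (\<Sum>l\<le>n. - real (Suc n) * ((-1) ^ l * real (n choose l) * real (Suc l) ^ m'))"
    proof (rule sum.cong[OF refl])
      fix l
      have "(-1) ^ Suc l * real (Suc n choose Suc l) * real (Suc l) ^ Suc m'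
        = - ((-1) ^ l * (real (Suc n choose Suc l) * real (Suc l)) * real (Suc l) ^ m')"
        by (simp only: power_Suc)
      also have "\<dots> = - real (Suc n) * ((-1) ^ l * real (n choose l) * real (Suc l) ^ m')"
        unfolding absorb by (simp only: mult_minus_left mult.assoc mult.left_commute mult.commute)
      finally show "(-1) ^ Suc l * real (Suc n choose Suc l) * real (Suc l) ^ Suc m' =
          - real (Suc n) * ((-1) ^ l * real (n choose l) * real (Suc l) ^ m')" .
    qed
    also have "\<dots> = - real (Suc n) * (\<Sum>l\<le>n. (-1) ^ l * real (n choose l) * real (Suc l) ^ m')"
      by (simp only: sum_distrib_left)
    also have "(\<Sum>l\<le>n. (-1) ^ l * real (n choose l) * real (Suc l) ^ m')
        = (\<Sum>l\<le>n. \<Sum>a\<le>m'. real (m' choose a) * ((-1) ^ l * real (n choose l) * real l ^ a))"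
    proof (rule sum.cong[OF refl])
      fix l
      have "real (Suc l) ^ m' = (real l + 1) ^ m'" by (simp add: add.commute)
      also have "\<dots> = (\<Sum>a\<le>m'. real (m' choose a) * real l ^ a)"
        by (simp add: binomial_ring)
      finally show "(-1) ^ l * real (n choose l) * real (Suc l) ^ m' =
          (\<Sum>a\<le>m'. real (m' choose a) * ((-1) ^ l * real (n choose l) * real l ^ a))"
        by (simp add: sum_distrib_left mult_ac)
    qed
    also have "\<dots> = (\<Sum>a\<le>m'. real (m' choose a) * (\<Sum>l\<le>n. (-1) ^ l * real (n choose l) * real l ^ a))"
      by (subst sum.swap) (simp add: sum_distrib_left)
    also have "\<dots> = (\<Sum>a\<le>m'. real (m' choose a) * (if a = n then (-1) ^ n * fact n else 0))"
      using m' by (intro sum.cong refl arg_cong2[where f = "(*)"] Suc.IH) auto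
    also have "\<dots> = (\<Sum>a\<le>m'. if a = n then real (m' choose n) * ((-1) ^ n * fact n) else 0)"
      by (intro sum.cong) auto
    also have "\<dots> = (if m' = n then (-1) ^ n * fact n else 0)"
      using m' by auto
    finally have eq: "(\<Sum>l\<le>Suc n. (-1) ^ l * real (Suc n choose l) * real l ^ m)
        = - real (Suc n) * (if m' = n then (-1) ^ n * fact n else 0)" .
    show ?thesis unfolding eq using Suc by (auto simp: algebra_simps)
  qed
qed simp

lemma finite_difference_poly:
  assumes "degree Q \<le> n"
  shows "(\<Sum>l\<le>n. (-1) ^ l * real (n choose l) * poly Q (real l)) = (-1) ^ n * fact n * coeff Q n"
proof -
  have Q: "poly Q x = (\<Sum>m\<le>n. coeff Q m * x ^ m)" for x
    unfolding poly_altdef using assms by (intro sum.mono_neutral_left) (auto simp: coeff_eq_0)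
  have "(\<Sum>l\<le>n. (-1) ^ l * real (n choose l) * poly Q (real l))
      = (\<Sum>l\<le>n. \<Sum>m\<le>n. coeff Q m * ((-1) ^ l * real (n choose l) * real l ^ m))"
    by (simp add: Q sum_distrib_left mult_ac)
  also have "\<dots> = (\<Sum>m\<le>n. coeff Q m * (\<Sum>l\<le>n. (-1) ^ l * real (n choose l) * real l ^ m))"
    by (subst sum.swap) (simp add: sum_distrib_left)
  also have "\<dots> = (\<Sum>m\<le>n. if m = n then coeff Q n * ((-1) ^ n * fact n) else 0)"
    by (intro sum.cong) (auto simp: finite_difference_monomial)
  finally show ?thesis by simp
qed

lemma hankel_entry: "hankel H \<Longrightarrow> H i j = H 0 (i + j)"
proof (induction i arbitrary: j)
  case (Suc i)
  have "H (Suc i) j = H i (Suc j)" using Suc.prems by (simp add: hankel_def)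
  also have "\<dots> = H 0 (i + Suc j)" by (rule Suc.IH[OF Suc.prems])
  finally show ?case by simp
qed simp

lemma Phi_sobolev_term:
  assumes H: "hankel H" and k: "k \<le> n"
  shows "Phi (sobolev_term k H) (2 * n) i j = (if k = n then (-1) ^ n * fact (2 * n) * H i j else 0)"
proof -
  let ?f = "falling_fact_poly k"
  \<comment> \<open>\<open>Q\<close> is the product of the two falling factorials at
    \<open>i + 2 * n - l\<close> and \<open>j + l\<close>, as a polynomial in \<open>l\<close>. The
    slope -1 in the first factor gives it leading coefficient \<open>(-1) ^ k\<close>. The entry of
    \<open>H\<close> is the constant \<open>c\<close>, since the index sum does not depend on
    \<open>l\<close>.\<close>
  define Q where "Q = pcompose ?f [:real (i + 2 * n), -1:] * pcompose ?f [:real j, 1:]"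
  define c where "c = H 0 (i + j + 2 * n - 2 * k)"
  have d: "degree (pcompose ?f [:real (i + 2 * n), -1:]) = k" "degree (pcompose ?f [:real j, 1:]) = k"
    by (simp_all add: degree_pcompose degree_falling_fact_poly)
  have l: "lead_coeff (pcompose ?f [:real (i + 2 * n), -1:]) = (-1) ^ k"
    "lead_coeff (pcompose ?f [:real j, 1:]) = 1"
    by (simp_all add: lead_coeff_comp coeff_falling_fact_poly degree_falling_fact_poly)
  have nz: "pcompose ?f [:real (i + 2 * n), -1:] \<noteq> 0" "pcompose ?f [:real j, 1:] \<noteq> 0"
    using l by auto
  have dQ: "degree Q = 2 * k" unfolding Q_def unfolding degree_mult_eq[OF nz] d by simp
  have lQ: "lead_coeff Q = (-1) ^ k" unfolding Q_def using l by (simp add: lead_coeff_mult)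
  have entry: "sobolev_term k H (i + (2 * n - l)) (j + l) = poly Q (real l) * c" if l: "l \<le> 2 * n" for l
  \<comment> \<open>If an index falls below \<open>k\<close>, truncated subtraction may select an
    entry of \<open>H\<close> other than \<open>c\<close>, but then one falling factorial is
    zero.\<close>
  proof (cases "k \<le> i + (2 * n - l) \<and> k \<le> j + l")
    case True
    then have "i + (2 * n - l) - k + (j + l - k) = i + j + 2 * n - 2 * k" using l by linarith
    then have "H (i + (2 * n - l) - k) (j + l - k) = c"
      unfolding c_def using hankel_entry[OF H, of "i + (2 * n - l) - k"] by simp
    then show ?thesis
      using l by (simp add: sobolev_term_entry Q_def poly_pcompose of_nat_diff algebra_simps)
  next
    case False
    have "poly ?f (real (i + (2 * n - l))) * poly ?f (real (j + l)) = poly Q (real l)"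
      using l by (simp add: Q_def poly_pcompose of_nat_diff algebra_simps)
    moreover have "poly ?f (real (i + (2 * n - l))) * poly ?f (real (j + l)) = 0"
      using False unfolding mult_eq_0_iff poly_falling_fact_poly by auto
    ultimately show ?thesis by (simp add: sobolev_term_entry)
  qed
  have "Phi (sobolev_term k H) (2 * n) i j
      = (\<Sum>l\<le>2 * n. (-1) ^ l * real (2 * n choose l) * poly Q (real l)) * c"
    unfolding Phi_entry sum_distrib_right using entry by (intro sum.cong) auto
  \<comment> \<open>The sign of a difference of even order \<open>2 * n\<close> is 1; the sign
    compensated in \<open>hankel_part\<close> comes from the leading coefficient of
    \<open>Q\<close>.\<close>
  also have "\<dots> = fact (2 * n) * coeff Q (2 * n) * c"
    using dQ k by (subst finite_difference_poly) auto
  also have "\<dots> = (if k = n then (-1) ^ n * fact (2 * n) * H i j else 0)"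
  proof (cases "k = n")
    case True
    then have "coeff Q (2 * n) = (-1) ^ n" "c = H i j"
      using dQ lQ hankel_entry[OF H, of i j] by (auto simp: c_def)
    then show ?thesis using True by simp
  qed (use dQ k in \<open>simp add: coeff_eq_0\<close>)
  finally show ?thesis .
qed

lemma Phi_sum: "Phi (\<lambda>i j. \<Sum>k\<in>K. A k i j) \<eta> i j = (\<Sum>k\<in>K. Phi (A k) \<eta> i j)"
  unfolding Phi_entry by (subst sum.swap) (simp add: sum_distrib_left)

lemma hankel_part_sobolev_sum:
  assumes "\<And>k. hankel (H k)"
  shows "hankel_part (\<lambda>i j. \<Sum>k\<le>n. sobolev_term k (H k) i j) n = H n"
proof (intro ext)
  fix i j
  have "(\<Sum>k\<le>n. Phi (sobolev_term k (H k)) (2 * n) i j)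
      = (\<Sum>k\<le>n. if k = n then (-1) ^ n * fact (2 * n) * H n i j else 0)"
    by (intro sum.cong) (auto simp: Phi_sobolev_term[OF assms])
  then show "hankel_part (\<lambda>i j. \<Sum>k\<le>n. sobolev_term k (H k) i j) n i j = H n i j"
    by (simp add: hankel_part_def Phi_sum power_add[symmetric] mult_2[symmetric] field_simps)
qed

text \<open>At each stage \<open>hankel_part\<close> returns exactly the top Hankel matrix, so the
  recursion strips off one term. Hence it reproduces any given decomposition.\<close>

lemma residual_mat_sobolev_sum:
  assumes "\<And>k. hankel (H k)" and "k \<le> d"
  shows "residual_mat (\<lambda>i j. \<Sum>n\<le>d. sobolev_term n (H n) i j) d k
    = (\<lambda>i j. \<Sum>n\<le>d - k. sobolev_term n (H n) i j)"
  using assms(2)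
proof (induction k)
  case (Suc k)
  have "hankel_part (\<lambda>i j. \<Sum>n\<le>d - k. sobolev_term n (H n) i j) (d - k) = H (d - k)"
    by (rule hankel_part_sobolev_sum) (rule assms(1))
  moreover have "d - k = Suc (d - Suc k)" using Suc.prems by simp
  ultimately show ?case using Suc by simp
qed simp

lemma hankel_comp_sobolev_sum:
  assumes "\<And>k. hankel (H k)" and "k \<le> d"
  shows "hankel_comp (\<lambda>i j. \<Sum>n\<le>d. sobolev_term n (H n) i j) d k = H (d - k)"
  unfolding hankel_comp_def residual_mat_sobolev_sum[of H, OF assms]
  by (rule hankel_part_sobolev_sum) (rule assms(1))

lemma hankel_sobolev_index_iff:
  "hankel_sobolev_index M d \<longleftrightarrow>
    (\<exists>H. (\<forall>k. hankel (H k)) \<and> M = (\<lambda>i j. \<Sum>k\<le>d. sobolev_term k (H k) i j) \<and>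
       H d \<noteq> inf_null \<and> (\<forall>k>d. H k = inf_null))"
proof -
  have "(\<Sum>k. sobolev_term k (H k) i j) = (\<Sum>k\<le>d. sobolev_term k (H k) i j)"
    if "\<forall>k>d. H k = inf_null" for H :: "nat \<Rightarrow> inf_mat" and i j
    using that by (intro suminf_finite) (auto simp: sobolev_term_entry inf_null_def)
  then show ?thesis
    unfolding hankel_sobolev_index_def sobolev_decomposition_def
    by (intro ex_cong1) (auto simp: fun_eq_iff)
qed

section \<open>Inverses of lower triangular infinite matrices and the moment matrix\<close>

fun lower_right_inverse :: "inf_mat \<Rightarrow> nat \<Rightarrow> nat \<Rightarrow> real" where
  "lower_right_inverse A i j =
     ((if i = j then 1 else 0) - (\<Sum>k<i. A i k * lower_right_inverse A k j)) / A i i"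

declare lower_right_inverse.simps [simp del]

lemma inf_mult_lower:
  assumes "lower_triangular A" and "i \<le> n"
  shows "(A \<star> B) i j = (\<Sum>k\<le>n. A i k * B k j)"
  unfolding inf_mult_def using assms
  by (intro suminf_finite) (auto simp: lower_triangular_def)

text \<open>Lower triangularity of the two left factors confines every sum in row \<open>i\<close>
  to indices up to \<open>i\<close>, so the order of summation can be exchanged for an arbitrary
  \<open>C\<close>.\<close>

lemma inf_mult_assoc:
  assumes "lower_triangular A" and "lower_triangular B"
  shows "(A \<star> B) \<star> C = A \<star> (B \<star> C)"
proof (intro ext)
  fix i j
  have AB: "lower_triangular (A \<star> B)"
    unfolding lower_triangular_def
  proof (intro allI impI)
    fix i j :: nat assume "i < j"
    then show "(A \<star> B) i j = 0"
      using assms by (subst inf_mult_lower[OF assms(1) order_refl])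
        (auto intro!: sum.neutral simp: lower_triangular_def)
  qed
  have "((A \<star> B) \<star> C) i j = (\<Sum>k\<le>i. (\<Sum>l\<le>i. A i l * B l k) * C k j)"
    by (simp add: inf_mult_lower[OF AB order_refl] inf_mult_lower[OF assms(1) order_refl])
  also have "\<dots> = (\<Sum>l\<le>i. A i l * (\<Sum>k\<le>i. B l k * C k j))"
    unfolding sum_distrib_right sum_distrib_left by (subst sum.swap) (simp add: mult.assoc)
  also have "\<dots> = (A \<star> (B \<star> C)) i j"
    by (simp add: inf_mult_lower[OF assms(1) order_refl] inf_mult_lower[OF assms(2), where n = i])
  finally show "((A \<star> B) \<star> C) i j = (A \<star> (B \<star> C)) i j" .
qed

lemma inf_mult_unit [simp]: "A \<star> inf_unit = A" "inf_unit \<star> A = A"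
proof -
  have "(A \<star> inf_unit) i j = A i j" "(inf_unit \<star> A) i j = A i j" for i j
    by (subst inf_mult_single_right[of j], auto simp: inf_unit_def)
       (subst inf_mult_single_left[of i], auto simp: inf_unit_def)
  then show "A \<star> inf_unit = A" "inf_unit \<star> A = A" by (simp_all add: fun_eq_iff)
qed

text \<open>This is forward substitution: row \<open>i\<close> of A X = I is solved for
  \<open>X i j\<close> in terms of earlier rows.\<close>

lemma lower_right_inverse:
  assumes A: "lower_triangular A" and nz: "\<And>i. A i i \<noteq> 0"
  shows "lower_triangular (lower_right_inverse A)" and "A \<star> lower_right_inverse A = inf_unit"
proof -
  have "lower_right_inverse A i j = 0" if "i < j" for i j
    using that by (induction i rule: less_induct) (subst lower_right_inverse.simps, simp)
  then show "lower_triangular (lower_right_inverse A)" by (simp add: lower_triangular_def)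
  show "A \<star> lower_right_inverse A = inf_unit"
  proof (intro ext)
    fix i j
    have "(A \<star> lower_right_inverse A) i j = (\<Sum>k\<le>i. A i k * lower_right_inverse A k j)"
      by (rule inf_mult_lower[OF A order_refl])
    also have "\<dots> = (\<Sum>k<i. A i k * lower_right_inverse A k j) + A i i * lower_right_inverse A i j"
      by (simp add: lessThan_Suc_atMost[symmetric])
    also have "\<dots> = (if i = j then 1 else 0)"
      by (subst (2) lower_right_inverse.simps) (simp add: nz)
    finally show "(A \<star> lower_right_inverse A) i j = inf_unit i j" by (simp add: inf_unit_def)
  qed
qed

text \<open>The right inverse B of A has nonzero diagonal and so a right inverse C; then A = A (B C)
  = (A B) C = C, which makes B two-sided. Cancelling A gives uniqueness, so the definite description
  denotes B.\<close>

lemma lower_inverse: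
  assumes A: "lower_triangular A" and nz: "\<And>i. A i i \<noteq> 0"
  shows "lower_triangular (lower_inverse A)" and "A \<star> lower_inverse A = inf_unit"
proof -
  define B where "B = lower_right_inverse A"
  have B: "lower_triangular B" "A \<star> B = inf_unit"
    unfolding B_def by (rule lower_right_inverse[OF assms])+
  have Bnz: "B i i \<noteq> 0" for i
  proof -
    have "1 = (A \<star> B) i i" by (simp add: B inf_unit_def)
    also have "\<dots> = (\<Sum>k\<le>i. A i k * B k i)" by (rule inf_mult_lower[OF A order_refl])
    also have "\<dots> = A i i * B i i"
      using B(1) by (subst sum.remove[of _ i]) (auto simp: lower_triangular_def)
    finally show ?thesis by auto
  qed
  define C where "C = lower_right_inverse B"
  have C: "B \<star> C = inf_unit" unfolding C_def by (rule lower_right_inverse[OF B(1) Bnz])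
  have "A = C" using inf_mult_assoc[OF A B(1), of C] B C by simp
  with C have BA: "B \<star> A = inf_unit" by simp
  have uniq: "B' = B" if "A \<star> B' = inf_unit" for B'
    using inf_mult_assoc[OF B(1) A, of B'] BA that by simp
  have "lower_triangular (lower_inverse A) \<and> A \<star> lower_inverse A = inf_unit \<and> lower_inverse A \<star> A = inf_unit"
    unfolding lower_inverse_def
  proof (rule theI[where a = B and P = "\<lambda>B. lower_triangular B \<and> A \<star> B = inf_unit \<and> B \<star> A = inf_unit"])
    show "lower_triangular B \<and> A \<star> B = inf_unit \<and> B \<star> A = inf_unit" using B BA by simp
    show "B' = B" if "lower_triangular B' \<and> A \<star> B' = inf_unit \<and> B' \<star> A = inf_unit" for B'
      using uniq that by blast
  qed
  then show "lower_triangular (lower_inverse A)" "A \<star> lower_inverse A = inf_unit" by auto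
qed

text \<open>The recurrence divides the leading coefficient by the superdiagonal entry of
  \<open>G\<close>, which is nonzero. The coefficient matrix is therefore lower triangular with
  nonzero diagonal, as inversion requires.\<close>

lemma gen_poly_coeff:
  assumes G: "nondegenerate_hessenberg G" and t: "t \<noteq> 0"
  shows "coeff (gen_poly G t n) n \<noteq> 0" and "\<And>k. k > n \<Longrightarrow> coeff (gen_poly G t n) k = 0"
proof -
  have "coeff (gen_poly G t n) n \<noteq> 0 \<and> (\<forall>k>n. coeff (gen_poly G t n) k = 0)"
  proof (induction n rule: less_induct)
    case (less n)
    show ?case
    proof (cases n)
      case 0
      then show ?thesis using t by (auto simp: coeff_pCons split: nat.splits)
    next
      case (Suc m)
      have IH: "coeff (gen_poly G t i) k = 0" if "i \<le> m" "k > i" for i k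
        using less.IH[of i] that Suc by simp
      have "coeff (gen_poly G t n) (Suc k) = 1 / G m n * coeff (gen_poly G t m) k" if "k \<ge> m" for k
      proof -
        have "(\<Sum>i\<le>m. G m i * coeff (gen_poly G t i) (Suc k)) = 0"
          using that by (intro sum.neutral) (auto simp: IH)
        then show ?thesis by (simp add: Suc coeff_sum coeff_pCons)
      qed
      moreover have "G m n \<noteq> 0" using G Suc by (simp add: nondegenerate_hessenberg_def)
      moreover have "coeff (gen_poly G t m) m \<noteq> 0" using less.IH[of m] Suc by simp
      ultimately show ?thesis
        using IH[of m] by (metis Suc Suc_less_eq2 divide_eq_0_iff le_refl less_imp_le mult_eq_0_iff zero_neq_one)
    qed
  qed
  then show "coeff (gen_poly G t n) n \<noteq> 0" "\<And>k. k > n \<Longrightarrow> coeff (gen_poly G t n) k = 0" by auto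
qed

text \<open>The corner entry is the square of the corner entry of the inverse. It will be the total
  mass of the measure of index 0.\<close>

lemma moment_mat_00_pos:
  assumes "nondegenerate_hessenberg G" and "t \<noteq> 0"
  shows "moment_mat G t 0 0 > 0"
proof -
  let ?T = "coeff_mat G t"
  define B where "B = lower_inverse ?T"
  have T: "lower_triangular ?T" "\<And>i. ?T i i \<noteq> 0"
    using gen_poly_coeff[OF assms] by (auto simp: lower_triangular_def coeff_mat_def)
  have B: "lower_triangular B" "?T \<star> B = inf_unit"
    unfolding B_def using lower_inverse[OF T] by auto
  have "1 = (?T \<star> B) 0 0" by (simp add: B inf_unit_def)
  also have "\<dots> = ?T 0 0 * B 0 0"
    using T(1) by (subst inf_mult_single_left[of 0]) (auto simp: lower_triangular_def)
  finally have "B 0 0 \<noteq> 0" by auto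
  moreover have "moment_mat G t 0 0 = B 0 0 * B 0 0"
    using B(1) unfolding moment_mat_def B_def
    by (subst inf_mult_single_left[of 0]) (auto simp: lower_triangular_def inf_transpose_def)
  ultimately show ?thesis by (simp add: zero_less_mult_iff) (metis less_linear)
qed

section \<open>Sobolev inner products as bilinear forms of Hankel-Sobolev matrices\<close>

lemma higher_pderiv_monom_falling:
  "(pderiv ^^ k) (Polynomial.monom 1 i) =
     Polynomial.monom (poly (falling_fact_poly k) (real i)) (i - k)"
proof (induction k)
  case (Suc k)
  have "(pderiv ^^ Suc k) (Polynomial.monom 1 i) =
      Polynomial.monom (real (i - k) * poly (falling_fact_poly k) (real i)) (i - Suc k)"
    by (simp add: Suc pderiv_monom)
  \<comment> \<open>For \<open>k > i\<close> both sides are zero, so the truncated subtraction does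
    no harm.\<close>
  also have "real (i - k) * poly (falling_fact_poly k) (real i) = poly (falling_fact_poly (Suc k)) (real i)"
    by (cases "k \<le> i", simp add: falling_fact_poly_Suc of_nat_diff)
       (simp add: falling_fact_poly_Suc poly_falling_fact_poly)
  finally show ?case .
qed (simp add: falling_fact_poly_def)

text \<open>The derivatives of order \<open>k\<close> of x^i and x^j multiply to two falling
  factorials times x^(i + j - 2k), or to zero if i or j is below \<open>k\<close>; integration gives
  the entry of \<open>sobolev_term\<close> at (i, j).\<close>

lemma sobolev_inner_moments:
  assumes "\<And>k. k \<le> d \<Longrightarrow> has_moments (\<mu> k) (h k)"
  shows "sobolev_inner d \<mu> p q = (\<Sum>i\<le>degree p. \<Sum>j\<le>degree q. coeff p i *
    (\<Sum>k\<le>d. sobolev_term k (\<lambda>a b. h k (a + b)) i j) * coeff q j)"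
proof -
  have D: "(pderiv ^^ k) r = (\<Sum>i\<le>degree r. Polynomial.smult (coeff r i * poly (falling_fact_poly k) (real i))
      (Polynomial.monom 1 (i - k)))" for k and r :: "real poly"
  proof -
    have "(pderiv ^^ k) r = (pderiv ^^ k) (\<Sum>i\<le>degree r. Polynomial.smult (coeff r i) (Polynomial.monom 1 i))"
      using poly_eq_sum_monom[of r "Suc (degree r)"] by (simp only: lessThan_Suc_atMost lessI)
    also have "\<dots> = (\<Sum>i\<le>degree r. Polynomial.smult (coeff r i) ((pderiv ^^ k) (Polynomial.monom 1 i)))"
      by (simp only: higher_pderiv_sum higher_pderiv_smult)
    finally show ?thesis by (simp add: higher_pderiv_monom_falling smult_monom)
  qed
  have "(\<integral>x. poly ((pderiv ^^ k) p) x * poly ((pderiv ^^ k) q) x \<partial>\<mu> k) =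
      (\<Sum>i\<le>degree p. \<Sum>j\<le>degree q. coeff p i * sobolev_term k (\<lambda>a b. h k (a + b)) i j * coeff q j)"
    if "k \<le> d" for k
  proof -
    have "(\<integral>x. poly ((pderiv ^^ k) p) x * poly ((pderiv ^^ k) q) x \<partial>\<mu> k) =
        moment_functional (h k) ((pderiv ^^ k) p * (pderiv ^^ k) q)"
      using has_momentsD(4)[OF assms[OF that], of "(pderiv ^^ k) p * (pderiv ^^ k) q"] by simp
    then show ?thesis
      unfolding D[of k p] D[of k q]
      by (simp add: sum_product moment_functional_linear mult_monom moment_functional_monom
          sobolev_term_entry mult_ac)
  qed
  then have "sobolev_inner d \<mu> p q = (\<Sum>k\<le>d. \<Sum>i\<le>degree p. \<Sum>j\<le>degree q.
      coeff p i * sobolev_term k (\<lambda>a b. h k (a + b)) i j * coeff q j)"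
    by (simp add: sobolev_inner_def)
  also have "\<dots> = (\<Sum>i\<le>degree p. \<Sum>j\<le>degree q. \<Sum>k\<le>d.
      coeff p i * sobolev_term k (\<lambda>a b. h k (a + b)) i j * coeff q j)"
    by (subst sum.swap, rule sum.cong[OF refl], rule sum.swap)
  finally show ?thesis by (simp add: sum_distrib_left sum_distrib_right)
qed

lemma bilinear_sum_monom:
  fixes M :: inf_mat
  shows "(\<Sum>a\<le>degree (Polynomial.monom (1 :: real) i). \<Sum>b\<le>degree (Polynomial.monom (1 :: real) j).
    coeff (Polynomial.monom 1 i) a * M a b * coeff (Polynomial.monom 1 j) b) = M i j"
proof -
  have "(\<Sum>a\<le>i. \<Sum>b\<le>j. coeff (Polynomial.monom 1 i) a * M a b * coeff (Polynomial.monom 1 j) b)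
      = (\<Sum>a\<le>i. \<Sum>b\<le>j. if b = j then if a = i then M i j else 0 else 0)"
    by (intro sum.cong) auto
  then show ?thesis by (simp add: degree_monom_eq)
qed

section \<open>Equivalence of measures and positive definite Hankel components\<close>

theorem theorem12:
  fixes G :: inf_mat and t :: real
  assumes "nondegenerate_hessenberg G" and "t > 0"
  shows "(\<exists>d \<mu>. discrete_sobolev_measures d \<mu> \<and>
            (\<forall>p q :: real poly. sobolev_inner d \<mu> p q = formal_inner G t p q))
     \<longleftrightarrow>
         (\<exists>d. hessenberg_sobolev_index G t d \<and>
            pos_def_infinite (hankel_comp (moment_mat G t) d 0) \<and>
            (\<forall>k\<in>{1..d}. \<exists>m. pos_def_order (hankel_comp (moment_mat G t) d k) m))"
    (is "?L \<longleftrightarrow> ?R")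
proof
  let ?M = "moment_mat G t"
  assume ?L
  then obtain d \<mu> where \<mu>: "discrete_sobolev_measures d \<mu>"
    and eq: "\<And>p q. sobolev_inner d \<mu> p q = formal_inner G t p q" by blast
  define h where "h k n = (\<integral>x. x ^ n \<partial>\<mu> k)" for k n
  \<comment> \<open>Values of \<open>\<mu>\<close> beyond \<open>d\<close> are arbitrary, so the
    Hankel sequence is cut off by null matrices there.\<close>
  define H where "H k = (if k \<le> d then \<lambda>a b. h k (a + b) else inf_null)" for k
  have mom: "has_moments (\<mu> k) (h k)" if "k \<le> d" for k
    using \<mu> that unfolding h_def discrete_sobolev_measures_def by (intro has_moments_integral) auto
  have Hk: "hankel (H k)" for k by (simp add: H_def hankel_def inf_null_def)
  have M: "?M = (\<lambda>i j. \<Sum>k\<le>d. sobolev_term k (H k) i j)"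
  proof (intro ext)
    fix i j
    \<comment> \<open>Testing the two inner products on monomials reads off the matrix
      entries.\<close>
    have "?M i j = formal_inner G t (Polynomial.monom 1 i) (Polynomial.monom 1 j)"
      unfolding formal_inner_def by (rule bilinear_sum_monom[symmetric])
    also have "\<dots> = (\<Sum>k\<le>d. sobolev_term k (\<lambda>a b. h k (a + b)) i j)"
      unfolding eq[symmetric]
      by (rule trans[OF sobolev_inner_moments[of d \<mu> h] bilinear_sum_monom]) (rule mom)
    finally show "?M i j = (\<Sum>k\<le>d. sobolev_term k (H k) i j)" by (simp add: H_def)
  qed
  have pd: "pos_def_infinite (H d)"
    using \<mu> pos_def_below_support[OF mom[OF order_refl]]
    by (simp add: H_def pos_def_infinite_iff discrete_sobolev_measures_def)
  have "H d \<noteq> inf_null"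
  proof
    assume "H d = inf_null"
    then have "leading_minor (H d) 1 = 0"
      by (simp add: leading_minor_def inf_null_def det_single)
    with pd show False by (auto simp: pos_def_infinite_def)
  qed
  then have "hessenberg_sobolev_index G t d"
    unfolding hessenberg_sobolev_index_def hankel_sobolev_index_iff using Hk M
    by (intro exI[of _ H]) (auto simp: H_def)
  moreover have "hankel_comp ?M d k = H (d - k)" if "k \<le> d" for k
    unfolding M by (rule hankel_comp_sobolev_sum[OF Hk that])
  moreover have "\<exists>m. pos_def_order (H (d - k)) m" if "k \<in> {1..d}" for k
  proof -
    have "finite (measure_support (\<mu> (d - k)))"
      using \<mu> that by (simp add: discrete_sobolev_measures_def)
    from pos_def_order_support[OF mom this] show ?thesis by (auto simp: H_def)
  qed
  ultimately show ?R using pd by (intro exI[of _ d]) auto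
next
  let ?M = "moment_mat G t"
  assume ?R
  then obtain d where "hessenberg_sobolev_index G t d"
    and pd: "pos_def_infinite (hankel_comp ?M d 0)"
    and po: "\<And>k. k \<in> {1..d} \<Longrightarrow> \<exists>m. pos_def_order (hankel_comp ?M d k) m" by blast
  then obtain H where Hk: "\<And>k. hankel (H k)" and M: "?M = (\<lambda>i j. \<Sum>k\<le>d. sobolev_term k (H k) i j)"
    unfolding hessenberg_sobolev_index_def hankel_sobolev_index_iff by blast
  define h where "h k n = H k 0 n" for k n
  have Hh: "H k = (\<lambda>a b. h k (a + b))" for k
    using hankel_entry[OF Hk] by (simp add: fun_eq_iff h_def)
  \<comment> \<open>The existential decomposition is identified with the recursively computed one,
    which transfers the definiteness conditions to \<open>H\<close>.\<close>
  have comp: "hankel_comp ?M d k = H (d - k)" if "k \<le> d" for k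
    unfolding M by (rule hankel_comp_sobolev_sum[OF Hk that])
  have "\<exists>\<nu>. has_moments \<nu> (h k) \<and> (k = d \<longrightarrow> infinite (measure_support \<nu>)) \<and>
      (k < d \<longrightarrow> finite (measure_support \<nu>))" if k: "k \<le> d" for k
  proof (cases "k = d")
    case True
    then have "pos_def_infinite (\<lambda>a b. h k (a + b))" using pd comp[of 0] by (simp add: Hh)
    then show ?thesis using True pos_def_infinite_imp_measure by blast
  next
    case False
    then have "d - k \<in> {1..d}" and dk: "d - (d - k) = k" using k by auto
    from po[OF this(1)] obtain m where "pos_def_order (\<lambda>a b. h k (a + b)) m"
      using comp[of "d - k"] unfolding dk Hh by auto
    then show ?thesis using False k pos_def_order_imp_measure by blast
  qed
  then obtain \<mu> where \<mu>: "\<And>k. k \<le> d \<Longrightarrow> has_moments (\<mu> k) (h k)"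
    "infinite (measure_support (\<mu> d))" "\<And>k. k < d \<Longrightarrow> finite (measure_support (\<mu> k))"
    by (metis le_refl less_imp_le)
  have "sobolev_inner d \<mu> p q = formal_inner G t p q" for p q
    unfolding formal_inner_def M Hh by (rule sobolev_inner_moments) (rule \<mu>(1))
  \<comment> \<open>For \<open>d > 0\<close> order 0 is allowed for \<open>H 0\<close>, so
    definiteness alone does not make \<open>\<mu> 0\<close> nonzero. Its mass is the corner entry of
    the moment matrix, to which only the term of index 0 contributes.\<close>
  moreover have "emeasure (\<mu> 0) UNIV > 0"
  proof -
    have "sobolev_term k (H k) 0 0 = (if k = 0 then H 0 0 0 else 0)" for k
      using poly_falling_fact_poly[of k 0] by (cases k) (auto simp: sobolev_term_entry)
    then have "?M 0 0 = h 0 0" by (simp add: M h_def)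
    then have "h 0 0 > 0" using moment_mat_00_pos[of G t] assms by simp
    moreover have "(\<integral>x. poly 1 x \<partial>\<mu> 0) = h 0 0"
      using has_momentsD(4)[OF \<mu>(1), of 0 1] by (simp add: moment_functional_def)
    moreover have "space (\<mu> 0) = UNIV"
      using has_momentsD(1)[OF \<mu>(1), of 0] by (metis space_borel sets_eq_imp_space_eq le0)
    ultimately have "measure (\<mu> 0) UNIV > 0" by simp
    then have "emeasure (\<mu> 0) UNIV \<noteq> 0" by (auto simp: measure_def)
    then show ?thesis by (simp add: zero_less_iff_neq_zero)
  qed
  ultimately have "discrete_sobolev_measures d \<mu>"
    using \<mu> has_momentsD[OF \<mu>(1)] by (auto simp: discrete_sobolev_measures_def)
  with \<open>\<And>p q. sobolev_inner d \<mu> p q = formal_inner G t p q\<close> show ?L by blast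
qed

end
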